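(* Let $\mathcal{L}$ be a countable language in the logic for metric structures. The isomorphism relation for proper $\mathcal{L}$-structures is smooth.
   Context: Metric structures. The logic is the one for possibly unbounded metric structures, in which $\mathcal{L}$ comes with domains of quantification, enumerated as $(D_n)_{n\in\mathbb{N}}$. For the coding below one may suppose, without loss of generality, that $\mathcal{L}$ contains only relation symbols, including a binary symbol $d$ for the metric (otherwise each function symbol is replaced with a relation symbol to be interpreted as the graph of the function), and that $\mathcal{L}$ has just one sort (the multi-sorted version is obtained by a suitable adaptation). Structures are separable, complete and nonempty. An $\mathcal{L}$-structure $M$ is proper if the interpretation $D^M$ in $M$ of every domain of quantification $D$ is compact. An isomorphism of $\mathcal{L}$-structures is an isometric bijection mapping the interpretation of each domain of quantification onto the corresponding one and preserving the values of all relations. Coding. Write $\mathbb{N}$ as an increasing union $\bigcup_nQ_n$ of infinite sets such that $Q_{n+1}\setminus Q_n$ is infinite for every $n$. With $|B|$ the arity of the relation symbol $B$, an $\mathcal{L}$-structure is coded by an element $f=(f_B)_B$ of $\prod_B\mathbb{R}^{\mathbb{N}^{|B|}}$, where $B$ varies over all the relation symbols of $\mathcal{L}$ (including $d$), with the right uniform continuity moduli. Such an $f$ codes the $\mathcal{L}$-structure $M$ whose support is the completion of $\mathbb{N}$ with respect to the metric $f_d$ on $\mathbb{N}$, where the interpretation of $D_n$ is the closure of $Q_n$ in $M$ and the interpretation of a relation symbol $B$ is the unique (uniformly) continuous extension of $f_B$ to $M^{|B|}$. The set of codes is Borel, and so is the set $\mathrm{Mod}_p(\mathcal{L})$ of codes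 for proper $\mathcal{L}$-structures. The isomorphism relation for proper $\mathcal{L}$-structures is the equivalence relation on the standard Borel space $\mathrm{Mod}_p(\mathcal{L})$ under which two codes are equivalent when the structures they code are isomorphic. Smoothness. An equivalence relation $E$ on a standard Borel space $X$ is smooth if it is Borel reducible to equality on a Polish space, i.e. there are a Polish space $Y$ and a Borel map $g:X\to Y$ with $x\,E\,x'\iff g(x)=g(x')$. *)

theory Defs
  imports "HOL-Analysis.Analysis"
begin

section \<open>Languages and structures\<close>

text \<open>
  A one-sorted relational language for possibly unbounded metric structures, whose domains of
  quantification are enumerated by the natural numbers.  As usual in this logic, the uniform
  continuity modulus of a relation symbol \<open>B\<close> may depend on the domains its arguments range over:
  \<open>modulus L B ns\<close> is the modulus prescribed on the product of the domains with indices
  \<open>ns = [n\<^sub>1, \<dots>, n\<^sub>k]\<close>, where \<open>k\<close> is the arity of \<open>B\<close>.  A single modulus for \<open>B\<close> is the special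
  case in which it does not depend on \<open>ns\<close>.
\<close>

record 's language =
  symbols :: "'s set"
  arity :: "'s \<Rightarrow> nat"
  dist_symbol :: 's
  modulus :: "'s \<Rightarrow> nat list \<Rightarrow> real \<Rightarrow> real"

definition countable_language :: "'s language \<Rightarrow> bool" where
  "countable_language L \<longleftrightarrow>
     countable (symbols L) \<and>
     dist_symbol L \<in> symbols L \<and> arity L (dist_symbol L) = 2 \<and>
     (\<forall>B\<in>symbols L. \<forall>ns. length ns = arity L B \<longrightarrow> (\<forall>\<epsilon>>0. modulus L B ns \<epsilon> > 0))"

definition respects_moduli ::
  "'s language \<Rightarrow> (nat \<Rightarrow> 'a set) \<Rightarrow> ('a \<Rightarrow> 'a \<Rightarrow> real) \<Rightarrow> ('s \<Rightarrow> 'a list \<Rightarrow> real) \<Rightarrow> bool" where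
  "respects_moduli L D \<delta> R \<longleftrightarrow>
     (\<forall>B\<in>symbols L. \<forall>ns. length ns = arity L B \<longrightarrow>
        (\<forall>\<epsilon>>0. \<forall>xs ys.
           list_all2 (\<lambda>x n. x \<in> D n) xs ns \<and> list_all2 (\<lambda>y n. y \<in> D n) ys ns \<and>
           (\<forall>i<arity L B. \<delta> (xs ! i) (ys ! i) < modulus L B ns \<epsilon>)
           \<longrightarrow> \<bar>R B xs - R B ys\<bar> \<le> \<epsilon>))"

record ('a, 's) mstructure =
  support :: "'a metric"
  domain :: "nat \<Rightarrow> 'a set"
  interp :: "'s \<Rightarrow> 'a list \<Rightarrow> real"

definition tuples :: "'a set \<Rightarrow> nat \<Rightarrow> 'a list set" where
  "tuples A k = {xs. set xs \<subseteq> A \<and> length xs = k}"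

definition is_structure :: "'s language \<Rightarrow> ('a, 's) mstructure \<Rightarrow> bool" where
  "is_structure L M \<longleftrightarrow>
     mspace (support M) \<noteq> {} \<and>
     mcomplete_of (support M) \<and>
     separable_space (mtopology_of (support M)) \<and>
     (\<forall>n. closedin (mtopology_of (support M)) (domain M n)) \<and>
     (\<forall>x\<in>mspace (support M). \<forall>y\<in>mspace (support M).
        interp M (dist_symbol L) [x, y] = mdist (support M) x y) \<and>
     respects_moduli L (domain M) (mdist (support M)) (interp M)"

definition proper_structure :: "'s language \<Rightarrow> ('a, 's) mstructure \<Rightarrow> bool" where
  "proper_structure L M \<longleftrightarrow>
     is_structure L M \<and> (\<forall>n. compactin (mtopology_of (support M)) (domain M n))"

definition isomorphic_structures ::
  "'s language \<Rightarrow> ('a, 's) mstructure \<Rightarrow> ('b, 's) mstructure \<Rightarrow> bool" where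
  "isomorphic_structures L M N \<longleftrightarrow>
     (\<exists>\<phi>. bij_betw \<phi> (mspace (support M)) (mspace (support N)) \<and>
        (\<forall>x\<in>mspace (support M). \<forall>y\<in>mspace (support M).
           mdist (support N) (\<phi> x) (\<phi> y) = mdist (support M) x y) \<and>
        (\<forall>n. \<phi> ` domain M n = domain N n) \<and>
        (\<forall>B\<in>symbols L. \<forall>xs\<in>tuples (mspace (support M)) (arity L B).
           interp N B (map \<phi> xs) = interp M B xs))"


section \<open>Coding\<close>

definition admissible_filtration :: "(nat \<Rightarrow> nat set) \<Rightarrow> bool" where
  "admissible_filtration Q \<longleftrightarrow>
     (\<Union>n. Q n) = UNIV \<and>
     (\<forall>n. infinite (Q n) \<and> Q n \<subseteq> Q (Suc n) \<and> infinite (Q (Suc n) - Q n))"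

text \<open>
  The product of the spaces of real-valued functions on \<open>k\<close>-tuples of natural numbers, where \<open>k\<close> is
  the arity of \<open>B\<close>, over all symbols \<open>B\<close>.  For a countable language the product sigma-algebra is
  the Borel sigma-algebra of the product topology.
\<close>

definition code_space :: "'s language \<Rightarrow> ('s \<Rightarrow> nat list \<Rightarrow> real) measure" where
  "code_space L = (\<Pi>\<^sub>M B\<in>symbols L. \<Pi>\<^sub>M ms\<in>tuples UNIV (arity L B). borel)"

definition code_dist :: "'s language \<Rightarrow> ('s \<Rightarrow> nat list \<Rightarrow> real) \<Rightarrow> nat \<Rightarrow> nat \<Rightarrow> real" where
  "code_dist L f m n = f (dist_symbol L) [m, n]"

definition codes ::
  "'s language \<Rightarrow> (nat \<Rightarrow> nat set) \<Rightarrow> ('s \<Rightarrow> nat list \<Rightarrow> real) set" where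
  "codes L Q =
     {f \<in> space (code_space L).
        Metric_space UNIV (code_dist L f) \<and> respects_moduli L Q (code_dist L f) f}"

text \<open>
  \<open>dense_limit L f S e B xs r\<close>: the values of \<open>f B\<close> tend to \<open>r\<close> along the tuples of natural numbers
  whose image under \<open>e\<close> tends to \<open>xs\<close> in the metric space \<open>S\<close>.
\<close>

definition dense_limit ::
  "'s language \<Rightarrow> ('s \<Rightarrow> nat list \<Rightarrow> real) \<Rightarrow> 'a metric \<Rightarrow> (nat \<Rightarrow> 'a) \<Rightarrow> 's \<Rightarrow> 'a list \<Rightarrow> real \<Rightarrow> bool"
  where
  "dense_limit L f S e B xs r \<longleftrightarrow>
     (\<forall>q. (\<forall>j. q j \<in> tuples UNIV (arity L B)) \<and>
          (\<forall>i<arity L B. (\<lambda>j. mdist S (e (q j ! i)) (xs ! i)) \<longlonglongrightarrow> 0)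
          \<longrightarrow> (\<lambda>j. f B (q j)) \<longlonglongrightarrow> r)"

text \<open>
  \<open>coded_by L Q f M\<close>: \<open>f\<close> codes \<open>M\<close>.  The map \<open>e\<close> exhibits the support of \<open>M\<close> as a completion of the
  natural numbers under \<open>code_dist L f\<close>.

  The value of \<open>interp M B\<close> on tuples from the domains is forced: it extends \<open>f B\<close> and, by
  \<open>is_structure\<close>, satisfies the prescribed moduli on products of domains.  The domains need
  not cover the completion, and moduli that depend on the domains do not control \<open>f B\<close> near a tuple
  which lies in no domain.  There \<open>interp M B\<close> is the limit of \<open>f B\<close> if it exists, and \<open>0\<close>
  otherwise.  Hence whenever \<open>f B\<close> has a continuous extension to all tuples (for instance if its
  modulus does not depend on the domains), \<open>interp M B\<close> is that extension.
\<close>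

definition coded_by ::
  "'s language \<Rightarrow> (nat \<Rightarrow> nat set) \<Rightarrow> ('s \<Rightarrow> nat list \<Rightarrow> real) \<Rightarrow> ('a, 's) mstructure \<Rightarrow> bool" where
  "coded_by L Q f M \<longleftrightarrow>
     is_structure L M \<and>
     (\<exists>e. range e \<subseteq> mspace (support M) \<and>
        (\<forall>m n. mdist (support M) (e m) (e n) = code_dist L f m n) \<and>
        mtopology_of (support M) closure_of range e = mspace (support M) \<and>
        (\<forall>n. domain M n = mtopology_of (support M) closure_of (e ` Q n)) \<and>
        (\<forall>B\<in>symbols L. \<forall>ms\<in>tuples UNIV (arity L B). interp M B (map e ms) = f B ms) \<and>
        (\<forall>B\<in>symbols L. \<forall>xs\<in>tuples (mspace (support M)) (arity L B).
           (\<nexists>n. set xs \<subseteq> domain M n) \<longrightarrow>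
             (if \<exists>r. dense_limit L f (support M) e B xs r
              then dense_limit L f (support M) e B xs (interp M B xs)
              else interp M B xs = 0)))"

text \<open>
  Completions are taken with points of type \<^typ>\<open>nat \<Rightarrow> real\<close>.  Every metric on the natural numbers
  has such a completion (send a point to its distance function), and the structure coded
  by \<open>f\<close> is unique up to isomorphism.
\<close>

definition Mod_p ::
  "'s language \<Rightarrow> (nat \<Rightarrow> nat set) \<Rightarrow> ('s \<Rightarrow> nat list \<Rightarrow> real) set" where
  "Mod_p L Q =
     {f \<in> codes L Q. \<exists>M :: (nat \<Rightarrow> real, 's) mstructure. coded_by L Q f M \<and> proper_structure L M}"

definition Mod_p_space ::
  "'s language \<Rightarrow> (nat \<Rightarrow> nat set) \<Rightarrow> ('s \<Rightarrow> nat list \<Rightarrow> real) measure" where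
  "Mod_p_space L Q = restrict_space (code_space L) (Mod_p L Q)"

definition isomorphism_relation ::
  "'s language \<Rightarrow> (nat \<Rightarrow> nat set) \<Rightarrow>
     (('s \<Rightarrow> nat list \<Rightarrow> real) \<times> ('s \<Rightarrow> nat list \<Rightarrow> real)) set" where
  "isomorphism_relation L Q =
     {(f, f'). f \<in> Mod_p L Q \<and> f' \<in> Mod_p L Q \<and>
        (\<exists>(M :: (nat \<Rightarrow> real, 's) mstructure) (M' :: (nat \<Rightarrow> real, 's) mstructure).
           coded_by L Q f M \<and> coded_by L Q f' M' \<and> isomorphic_structures L M M')}"


section \<open>Smooth equivalence relations\<close>

definition polish_topology :: "'a topology \<Rightarrow> bool" where
  "polish_topology T \<longleftrightarrow> completely_metrizable_space T \<and> separable_space T"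

definition borel_of :: "'a topology \<Rightarrow> 'a measure" where
  "borel_of T = sigma (topspace T) {U. openin T U}"

definition standard_borel :: "'a measure \<Rightarrow> bool" where
  "standard_borel X \<longleftrightarrow>
     (\<exists>T. polish_topology T \<and> topspace T = space X \<and> sets (borel_of T) = sets X)"

text \<open>
  Every Polish space is homeomorphic to a subspace of the countable power of the real line, so
  letting \<open>Y\<close> range over the Polish topologies with points of type \<^typ>\<open>nat \<Rightarrow> real\<close> (and arbitrary
  underlying set) is no restriction.
\<close>

definition smooth :: "'a measure \<Rightarrow> ('a \<times> 'a) set \<Rightarrow> bool" where
  "smooth X E \<longleftrightarrow>
     standard_borel X \<and> equiv (space X) E \<and>
     (\<exists>(Y :: (nat \<Rightarrow> real) topology) g.
        polish_topology Y \<and> g \<in> X \<rightarrow>\<^sub>M borel_of Y \<and>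
        (\<forall>x\<in>space X. \<forall>x'\<in>space X. (x, x') \<in> E \<longleftrightarrow> g x = g x'))"

end

theory Submission
  imports Defs "HOL-Library.Diagonal_Subsequence"
begin

text \<open>
  The isomorphism type of a proper structure \<open>M\<close> is determined by the closed sets of values which
  the relations take on finite tuples \<open>(x\<^sub>0, \<dots>, x\<^sub>m)\<close> with \<open>x\<^sub>i\<close> in a prescribed domain.  Such a set is
  determined by the rational boxes it meets, and, by continuity, a box is met by a tuple
  from the domains if and only if it is met by a tuple of codes; so this invariant is a Borel function
  of the code.  Conversely, if \<open>M\<close> and \<open>M'\<close> have the same invariant, then finite approximations to
  the type of the dense sequence of codes of \<open>M\<close> are realized in \<open>M'\<close>, and compactness of the domains
  yields a sequence in \<open>M'\<close> with exactly this type, that is, an embedding of \<open>M\<close> into \<open>M'\<close>.  By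
  symmetry there is an embedding of \<open>M'\<close> into \<open>M\<close>.  As a compact metric space is not isometric
  to a proper subset of itself, both map domains onto domains, hence are isomorphisms.

  The proper codes form a standard Borel space: a code is proper if and only if every \<open>Q\<^sub>n\<close> is
  totally bounded, and recording the least finite nets along with the code embeds the proper codes
  as a \<open>G\<^sub>\<delta>\<close> set in a countable power of the real line.
\<close>
section \<open>Metric and descriptive preliminaries\<close>

lemma euclidean_second_countable:
  "second_countable (euclidean :: 'a::second_countable_topology topology)"
proof -
  obtain B :: "'a set set" where "countable B" "topological_basis B"
    using ex_countable_basis by blast
  then show ?thesis
    unfolding second_countable_def
    by (metis open_openin topological_basis_def topological_basis_iff topological_basis_open)
qed

text \<open>Pull the topology of the codomain back along \<open>h\<close>: by injectivity
  \<open>h\<close> becomes a homeomorphism onto its image, and a G-delta subset of a Polish space is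
  Polish. Measurability of \<open>h\<close> and \<open>gen\<close> give the two inclusions between
  the Borel sets of this topology and \<open>sets X\<close>.\<close>

lemma standard_borelI:
  fixes h :: "'a \<Rightarrow> 'b::polish_space"
  assumes h: "h \<in> borel_measurable X" and inj: "inj_on h (space X)"
    and G: "gdelta_in euclidean (h ` space X)"
    and gen: "\<And>A. A \<in> sets X \<Longrightarrow> \<exists>C\<in>sets borel. A = h -` C \<inter> space X"
  shows "standard_borel X"
proof -
  define T where "T = pullback_topology (space X) h euclidean"
  define S where "S = subtopology euclidean (h ` space X)"
  have top: "topspace T = space X"
    by (simp add: T_def topspace_pullback_topology)
  have "homeomorphic_maps T S h (inv_into (space X) h)"
    unfolding homeomorphic_maps_def
  proof (intro conjI ballI)
    have "continuous_map T euclidean (id \<circ> h)"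
      unfolding T_def by (rule continuous_map_pullback) auto
    then show "continuous_map T S h"
      by (auto simp: S_def continuous_map_in_subtopology top)
    have "continuous_map S euclidean id"
      by (simp add: S_def)
    then have "continuous_map S euclidean (h \<circ> inv_into (space X) h)"
      by (rule continuous_map_eq) (auto simp: S_def f_inv_into_f)
    then show "continuous_map S T (inv_into (space X) h)"
      unfolding T_def
      by (rule continuous_map_pullback') (auto simp: S_def inv_into_into)
  qed (use inj in \<open>auto simp: top S_def f_inv_into_f\<close>)
  then have hom: "T homeomorphic_space S"
    by (auto simp: homeomorphic_space_def)
  have "completely_metrizable_space S"
    unfolding S_def
    by (intro completely_metrizable_space_gdelta_in completely_metrizable_space_euclidean G)
  with hom have "completely_metrizable_space T"
    by (simp add: homeomorphic_completely_metrizable_space)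
  moreover have "second_countable S"
    unfolding S_def by (intro second_countable_subtopology euclidean_second_countable)
  then have "separable_space T"
    using hom homeomorphic_space_second_countability second_countable_imp_separable_space by blast
  moreover have "sets (borel_of T) = sets X"
  proof -
    have opens: "{U. openin T U} = {h -` U \<inter> space X |U. U \<in> {U. open U}}"
      by (auto simp: T_def openin_pullback_topology)
    have "sets (borel_of T) = sigma_sets (space X) {U. openin T U}"
      unfolding borel_of_def top by (rule sets_measure_of) (use openin_subset top in blast)
    also have "\<dots> = {h -` A \<inter> space X |A. A \<in> sigma_sets UNIV {U. open U}}"
      unfolding opens by (rule sigma_sets_vimage_commute[symmetric]) simp
    also have "sigma_sets UNIV {U::'b set. open U} = sets borel"
      by (simp add: borel_def)
    also have "{h -` A \<inter> space X |A. A \<in> sets borel} = sets X"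
      using gen h by (auto intro: measurable_sets)
    finally show ?thesis .
  qed
  ultimately show ?thesis
    using top by (auto simp: standard_borel_def polish_topology_def)
qed

lemma borel_of_euclidean: "borel_of euclidean = borel"
  by (simp add: borel_of_def borel_def)

lemma polish_topology_euclidean: "polish_topology (euclidean :: 'a::polish_space topology)"
  using second_countable_imp_separable_space[OF euclidean_second_countable]
  by (simp add: polish_topology_def completely_metrizable_space_euclidean)

lemma gdelta_closed: "closed A \<Longrightarrow> gdelta_in euclidean (A :: 'a::metric_space set)"
  using closed_imp_gdelta_in[OF metrizable_space_euclidean] by simp

lemma gdelta_open: "open A \<Longrightarrow> gdelta_in euclidean A"
  by (simp add: open_imp_gdelta_in)

lemma gdelta_INT:
  "(\<And>i::'i::countable. gdelta_in euclidean {x. P i x}) \<Longrightarrow> gdelta_in euclidean {x. \<forall>i. P i x}"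
  unfolding Collect_all_eq by (rule gdelta_in_Inter) (simp, simp, blast)

lemma gdelta_conj:
  "gdelta_in euclidean {x. P x} \<Longrightarrow> gdelta_in euclidean {x. R x} \<Longrightarrow> gdelta_in euclidean {x. P x \<and> R x}"
  using gdelta_in_Int[of euclidean "{x. P x}" "{x. R x}"] by (simp add: Collect_conj_eq)

lemma gdelta_disj:
  "gdelta_in euclidean {x. P x} \<Longrightarrow> gdelta_in euclidean {x. R x} \<Longrightarrow> gdelta_in euclidean {x. P x \<or> R x}"
  using gdelta_in_Un[of euclidean "{x. P x}" "{x. R x}"] by (simp add: Collect_disj_eq)

lemma gdelta_imp:
  "gdelta_in euclidean {x. \<not> P x} \<Longrightarrow> gdelta_in euclidean {x. R x} \<Longrightarrow> gdelta_in euclidean {x. P x \<longrightarrow> R x}"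
  unfolding imp_conv_disj by (rule gdelta_disj)

section \<open>Limits, compactness and isometries in metric spaces\<close>

lemma (in Metric_space) dist_tendsto:
  assumes "\<And>j. x j \<in> M" "\<And>j. y j \<in> M" "a \<in> M" "b \<in> M"
    and x: "((\<lambda>j. d (x j) a) \<longlongrightarrow> 0) F" and y: "((\<lambda>j. d (y j) b) \<longlongrightarrow> 0) F"
  shows "((\<lambda>j. d (x j) (y j)) \<longlongrightarrow> d a b) F"
proof (rule LIM_zero_cancel, rule Lim_null_comparison)
  have "\<bar>d (x j) (y j) - d a b\<bar> \<le> d (x j) a + d (y j) b" for j
    using assms(1-4) triangle[of "x j" a "y j"] triangle[of a b "y j"]
      triangle[of a "x j" b] triangle[of "x j" "y j" b] commute
    by (smt (verit))
  then show "\<forall>\<^sub>F j in F. norm (d (x j) (y j) - d a b) \<le> d (x j) a + d (y j) b"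
    by simp
  show "((\<lambda>j. d (x j) a + d (y j) b) \<longlongrightarrow> 0) F"
    using tendsto_add[OF x y] by simp
qed

lemma (in Metric_space) closure_of_dense_sequence:
  assumes "x \<in> mtopology closure_of (e ` A)" "range e \<subseteq> M"
  obtains m where "\<And>j::nat. m j \<in> A" "(\<lambda>j. d (e (m j)) x) \<longlonglongrightarrow> 0"
proof -
  obtain \<sigma> where "range \<sigma> \<subseteq> e ` A" and lim: "limitin mtopology \<sigma> x sequentially"
    using assms(1) by (auto simp: closure_of_sequentially)
  then have "\<forall>j. \<exists>k. k \<in> A \<and> \<sigma> j = e k" by auto
  then obtain m where "\<And>j. m j \<in> A \<and> \<sigma> j = e (m j)" by metis
  with lim that show thesis
    by (auto simp: limitin_metric_dist_null)
qed

text \<open>If \<open>x\<close> has distance \<open>\<epsilon>\<close> from the image, then its orbit under \<open>T\<close> is \<open>\<epsilon>\<close>-separated.\<close>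

lemma (in Metric_space) isometry_of_compact_surj:
  assumes K: "compactin mtopology K" and T: "T ` K \<subseteq> K"
    and iso: "\<And>x y. x \<in> K \<Longrightarrow> y \<in> K \<Longrightarrow> d (T x) (T y) = d x y"
  shows "T ` K = K"
proof
  have KM: "K \<subseteq> M" and
    sub: "\<And>\<sigma>::nat\<Rightarrow>'a. range \<sigma> \<subseteq> K \<Longrightarrow> \<exists>l r. l \<in> K \<and> strict_mono r \<and> limitin mtopology (\<sigma> \<circ> r) l sequentially"
    using K unfolding compactin_sequentially by auto
  show "K \<subseteq> T ` K"
  proof
    fix x assume x: "x \<in> K"
    have orb: "(T ^^ n) z \<in> K" if "z \<in> K" for n z
      using that T by (induction n) auto
    have isoN: "d ((T ^^ n) a) ((T ^^ n) b) = d a b" if "a \<in> K" "b \<in> K" for n a b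
      using that by (induction n) (auto simp: iso orb)
    have "\<exists>z\<in>K. d (T z) x < \<epsilon>" if "\<epsilon> > 0" for \<epsilon>
    proof -
      obtain l r where l: "l \<in> K" "strict_mono r" "limitin mtopology ((\<lambda>n. (T ^^ n) x) \<circ> r) l sequentially"
        using sub[of "\<lambda>n. (T ^^ n) x"] orb x by auto
      then have "\<exists>N. \<forall>n\<ge>N. d ((T ^^ r n) x) l < \<epsilon>/2"
        using half_gt_zero[OF that] unfolding limit_metric_sequentially comp_def by blast
      then obtain N where N: "\<And>n. n \<ge> N \<Longrightarrow> d ((T ^^ r n) x) l < \<epsilon>/2"
        by blast
      have lt: "r N < r (Suc N)" using l(2) by (simp add: strict_mono_def)
      \<comment> \<open>Subtracting 1 keeps one application of \<open>T\<close> outermost: once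
        \<open>T ^^ r N\<close> is cancelled by \<open>isoN\<close>, the point close to
        \<open>x\<close> has the form \<open>T z\<close> with \<open>z\<close> in
        \<open>K\<close>.\<close>
      define k where "k = r (Suc N) - r N - 1"
      have k: "r (Suc N) = r N + Suc k" using lt by (simp add: k_def)
      have "d ((T ^^ r (Suc N)) x) ((T ^^ r N) x) < \<epsilon>"
        using N[of N] N[of "Suc N"] triangle[of "(T ^^ r (Suc N)) x" l "(T ^^ r N) x"]
          commute[of "(T ^^ r N) x" l] orb[OF x] l(1) KM by fastforce
      moreover have "(T ^^ r (Suc N)) x = (T ^^ r N) (T ((T ^^ k) x))"
        unfolding k funpow_add by simp
      ultimately have "d (T ((T ^^ k) x)) x < \<epsilon>"
        using isoN[of "T ((T ^^ k) x)" x] orb[OF x, of "Suc k"] x by simp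
      then show ?thesis using orb[OF x] by blast
    qed
    then have "\<exists>z\<in>K. d (T z) x < inverse (real (Suc n))" for n
      by simp
    then obtain z where z: "\<And>n. z n \<in> K" "\<And>n. d (T (z n)) x < inverse (real (Suc n))"
      by metis
    have Tz: "(\<lambda>n. d (T (z n)) x) \<longlonglongrightarrow> 0"
      by (rule Lim_null_comparison[OF _ LIMSEQ_inverse_real_of_nat])
         (use z(2) in \<open>auto intro!: always_eventually less_imp_le\<close>)
    \<comment> \<open>A limit point of the approximate preimages is an exact preimage, because the
      isometry \<open>T\<close> carries the convergent subsequence to one that also tends to
      \<open>x\<close>.\<close>
    obtain l r where l: "l \<in> K" "strict_mono r" "limitin mtopology (z \<circ> r) l sequentially"
      using sub[of z] z(1) by auto
    have "(\<lambda>n. d (T (z (r n))) (T l)) \<longlonglongrightarrow> 0"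
      using l z(1) by (simp add: limitin_metric_dist_null iso)
    moreover have "(\<lambda>n. d (T (z (r n))) x) \<longlonglongrightarrow> 0"
      using LIMSEQ_subseq_LIMSEQ[OF Tz l(2)] by (simp add: comp_def)
    moreover have "T (z n) \<in> M" "T l \<in> M" "x \<in> M" for n
      using T KM z(1) l(1) x by auto
    ultimately have "T l = x"
      by (intro limitin_metric_unique[of "\<lambda>n. T (z (r n))" _ sequentially])
         (auto simp: limitin_metric_dist_null)
    with l(1) show "x \<in> T ` K" by blast
  qed
qed (rule T)

text \<open>This is sequential compactness of a countable product of compact sets. Convergence of
  one coordinate can be achieved by thinning any sequence and survives further thinning, so a
  diagonal sequence serves all coordinates.\<close>

lemma (in Metric_space) compactin_diagonal_subsequence:
  assumes K: "\<And>i::nat. compactin mtopology (K i)" and Y: "\<And>k i. Y k i \<in> K i"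
  obtains r l where "strict_mono (r::nat\<Rightarrow>nat)" "\<And>i. l i \<in> K i"
    "\<And>i. (\<lambda>k. d (Y (r k) i) (l i)) \<longlonglongrightarrow> 0"
proof -
  define P where "P i s \<longleftrightarrow> (\<exists>l\<in>K i. (\<lambda>k. d (Y (s k) i) l) \<longlonglongrightarrow> 0)" for i s
  interpret subseqs P
  proof
    fix i and s :: "nat \<Rightarrow> nat"
    have "range (\<lambda>k. Y (s k) i) \<subseteq> K i"
      using Y by blast
    then obtain l r where "l \<in> K i" "strict_mono r"
      "limitin mtopology ((\<lambda>k. Y (s k) i) \<circ> r) l sequentially"
      using K[of i] unfolding compactin_sequentially by meson
    then show "\<exists>r'. strict_mono r' \<and> P i (s \<circ> r')"
      unfolding P_def limitin_metric_dist_null comp_def by blast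
  qed
  have "P i (s \<circ> r)" if "strict_mono r" "P i s" for i s r
    using that LIMSEQ_subseq_LIMSEQ unfolding P_def comp_def by blast
  \<comment> \<open>The diagonal sequence refines the one chosen for coordinate \<open>i\<close>
    after a shift by \<open>Suc i\<close>; \<open>LIMSEQ_offset\<close> removes the shift
    below.\<close>
  then have "P i (diagseq \<circ> ((+) (Suc i)))" for i
    using diagseq_holds by blast
  then have "\<exists>l\<in>K i. (\<lambda>k. d (Y (diagseq (k + Suc i)) i) l) \<longlonglongrightarrow> 0" for i
    unfolding P_def comp_def add.commute[of _ "Suc i"] .
  then have "\<exists>l\<in>K i. (\<lambda>k. d (Y (diagseq k) i) l) \<longlonglongrightarrow> 0" for i
    using LIMSEQ_offset[of "\<lambda>k. d (Y (diagseq k) i) _" "Suc i"] by blast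
  then show thesis
    using that subseq_diagseq by metis
qed

text \<open>The assignment of \<open>y i\<close> to \<open>e i\<close> is 1-Lipschitz on a dense
  set, hence extends to the whole space by completeness of \<open>m2\<close>. The extension is
  isometric because both distances are limits along the same sequences of indices.\<close>

lemma isometry_extends:
  fixes m1 :: "'a metric" and m2 :: "'b metric" and e :: "nat \<Rightarrow> 'a"
  assumes comp: "mcomplete_of m2" and e: "range e \<subseteq> mspace m1"
    and dense: "mtopology_of m1 closure_of range e = mspace m1"
    and y: "range y \<subseteq> mspace m2"
    and iso: "\<And>i j. mdist m2 (y i) (y j) = mdist m1 (e i) (e j)"
  obtains \<phi> where "\<phi> \<in> mspace m1 \<rightarrow> mspace m2" "\<And>i. \<phi> (e i) = y i"
    "\<And>a b. a \<in> mspace m1 \<Longrightarrow> b \<in> mspace m1 \<Longrightarrow> mdist m2 (\<phi> a) (\<phi> b) = mdist m1 a b"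
proof -
  interpret M1: Metric_space "mspace m1" "mdist m1" by (rule Metric_space_mspace_mdist)
  interpret M2: Metric_space "mspace m2" "mdist m2" by (rule Metric_space_mspace_mdist)
  \<comment> \<open>\<open>e\<close> is not assumed injective. The index selected by
    \<open>inv_into\<close> does not matter: by \<open>iso\<close>, indices with the same
    \<open>e\<close>-value have \<open>y\<close>-values at distance 0.\<close>
  define f where "f = y \<circ> inv_into UNIV e"
  have f: "f (e i) = y i" for i
  proof -
    have "e (inv_into UNIV e (e i)) = e i" by (simp add: f_inv_into_f)
    then have "mdist m2 (f (e i)) (y i) = 0"
      using iso e by (simp add: f_def image_subset_iff)
    then show ?thesis using y by (simp add: f_def image_subset_iff)
  qed
  have "Lipschitz_continuous_map (submetric m1 (range e)) m2 f"
    unfolding Lipschitz_continuous_map_def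
    by (intro conjI exI[of _ 1]) (use y in \<open>auto simp: f iso\<close>)
  then obtain \<phi> where lip: "Lipschitz_continuous_map (submetric m1 (mtopology_of m1 closure_of range e)) m2 \<phi>"
    and ext: "\<And>x. x \<in> range e \<Longrightarrow> \<phi> x = f x"
    using Lipschitz_continuous_map_extends_to_closure_of[OF comp] by blast
  then have "Lipschitz_continuous_map m1 m2 \<phi>"
    by (simp add: dense)
  then obtain C where into: "\<phi> \<in> mspace m1 \<rightarrow> mspace m2"
    and C: "\<And>a b. a \<in> mspace m1 \<Longrightarrow> b \<in> mspace m1 \<Longrightarrow> mdist m2 (\<phi> a) (\<phi> b) \<le> C * mdist m1 a b"
    unfolding Lipschitz_continuous_map_def by auto
  have \<phi>e: "\<phi> (e i) = y i" for i using ext f by simp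
  have "mdist m2 (\<phi> a) (\<phi> b) = mdist m1 a b" if ab: "a \<in> mspace m1" "b \<in> mspace m1" for a b
  proof -
    have seq: "\<exists>u. (\<lambda>j. mdist m1 (e (u j)) c) \<longlonglongrightarrow> 0 \<and> (\<lambda>j. mdist m2 (y (u j)) (\<phi> c)) \<longlonglongrightarrow> 0"
      if c: "c \<in> mspace m1" for c
    proof -
      obtain u where u: "(\<lambda>j. mdist m1 (e (u j)) c) \<longlonglongrightarrow> 0"
        using M1.closure_of_dense_sequence[of c e UNIV] c dense e unfolding mtopology_of_def by metis
      have "(\<lambda>j. mdist m2 (y (u j)) (\<phi> c)) \<longlonglongrightarrow> 0"
      proof (rule Lim_null_comparison)
        show "\<forall>\<^sub>F j in sequentially. norm (mdist m2 (y (u j)) (\<phi> c)) \<le> C * mdist m1 (e (u j)) c"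
          using C[of "e (u j)" c for j] e c \<phi>e by (simp add: image_subset_iff)
        show "(\<lambda>j. C * mdist m1 (e (u j)) c) \<longlonglongrightarrow> 0"
          using tendsto_mult_left[OF u, of C] by simp
      qed
      with u show ?thesis by blast
    qed
    obtain u v where u: "(\<lambda>j. mdist m1 (e (u j)) a) \<longlonglongrightarrow> 0" "(\<lambda>j. mdist m2 (y (u j)) (\<phi> a)) \<longlonglongrightarrow> 0"
      and v: "(\<lambda>j. mdist m1 (e (v j)) b) \<longlonglongrightarrow> 0" "(\<lambda>j. mdist m2 (y (v j)) (\<phi> b)) \<longlonglongrightarrow> 0"
      using seq ab by meson
    have "(\<lambda>j. mdist m1 (e (u j)) (e (v j))) \<longlonglongrightarrow> mdist m1 a b"
      by (rule M1.dist_tendsto) (use e ab u v in auto)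
    moreover have "(\<lambda>j. mdist m2 (y (u j)) (y (v j))) \<longlonglongrightarrow> mdist m2 (\<phi> a) (\<phi> b)"
      by (rule M2.dist_tendsto) (use y into ab u v in auto)
    ultimately show ?thesis
      unfolding iso by (rule LIMSEQ_unique[symmetric])
  qed
  with into \<phi>e that show thesis by blast
qed

section \<open>Structures presented by codes\<close>

text \<open>The sets \<open>A i\<close> vary with the coordinate because different arguments of a
  relation may be confined to different domains.\<close>

lemma (in Metric_space) closure_of_dense_tuples:
  assumes "\<And>i. i < length xs \<Longrightarrow> xs ! i \<in> mtopology closure_of (e ` A i)" "range e \<subseteq> M"
  obtains q where "\<And>j::nat. length (q j) = length xs" "\<And>i j. i < length xs \<Longrightarrow> q j ! i \<in> A i"
    "\<And>i. i < length xs \<Longrightarrow> (\<lambda>j. d (e (q j ! i)) (xs ! i)) \<longlonglongrightarrow> 0"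
proof -
  have "\<exists>m. i < length xs \<longrightarrow> (\<forall>j. m j \<in> A i) \<and> (\<lambda>j. d (e (m j)) (xs ! i)) \<longlonglongrightarrow> 0" for i
  proof (cases "i < length xs")
    case True
    then show ?thesis
      using closure_of_dense_sequence[OF assms(1)[OF True] assms(2)] by blast
  qed simp
  then obtain m where "\<forall>i. i < length xs \<longrightarrow> (\<forall>j. m i j \<in> A i) \<and> (\<lambda>j. d (e (m i j)) (xs ! i)) \<longlonglongrightarrow> 0"
    using choice[of "\<lambda>i m. i < length xs \<longrightarrow> (\<forall>j. m j \<in> A i) \<and> (\<lambda>j. d (e (m j)) (xs ! i)) \<longlonglongrightarrow> 0"]
    by blast
  then show thesis
    by (intro that[of "\<lambda>j. map (\<lambda>i. m i j) [0..<length xs]"]) auto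
qed

text \<open>By density some sequence of codes tends to \<open>xs\<close>, so
  \<open>dense_limit\<close> is not vacuous and both candidates are limits of one real
  sequence.\<close>

lemma dense_limit_unique:
  assumes e: "range e \<subseteq> mspace S" and dense: "mtopology_of S closure_of range e = mspace S"
    and xs: "xs \<in> tuples (mspace S) (arity L B)"
    and "dense_limit L f S e B xs r" "dense_limit L f S e B xs r'"
  shows "r = r'"
proof -
  interpret Metric_space "mspace S" "mdist S" by (rule Metric_space_mspace_mdist)
  obtain q where q: "\<And>j::nat. length (q j) = length xs"
    "\<And>i. i < length xs \<Longrightarrow> (\<lambda>j. mdist S (e (q j ! i)) (xs ! i)) \<longlonglongrightarrow> 0"
    by (rule closure_of_dense_tuples[of xs e "\<lambda>_. UNIV"])
       (use xs e dense in \<open>auto simp: mtopology_of_def tuples_def\<close>)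
  have "(\<lambda>j. f B (q j)) \<longlonglongrightarrow> r" "(\<lambda>j. f B (q j)) \<longlonglongrightarrow> r'"
    using assms(4,5) q xs unfolding dense_limit_def by (auto simp: tuples_def)
  then show ?thesis by (rule LIMSEQ_unique)
qed

text \<open>Confining the \<open>i\<close>-th entry of a sequence to the domain of index
  \<open>rank Q i\<close> puts it in every domain of index \<open>n\<close> with
  \<open>i \<in> Q n\<close>, and in a compact set if the structure is proper.\<close>

definition rank :: "(nat \<Rightarrow> nat set) \<Rightarrow> nat \<Rightarrow> nat" where
  "rank Q i = (LEAST n. i \<in> Q n)"

lemma rank_le: "i \<in> Q n \<Longrightarrow> rank Q i \<le> n"
  unfolding rank_def by (rule Least_le)

lemma in_rank: "admissible_filtration Q \<Longrightarrow> i \<in> Q (rank Q i)"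
  unfolding rank_def admissible_filtration_def by (rule LeastI_ex) blast

lemma admissible_mono: "admissible_filtration Q \<Longrightarrow> m \<le> n \<Longrightarrow> Q m \<subseteq> Q n"
  using lift_Suc_mono_le[of Q m n] by (simp add: admissible_filtration_def)

lemma respects_moduliD:
  assumes "respects_moduli L D \<delta> R" "B \<in> symbols L" "length ns = arity L B" "\<epsilon> > 0"
    "list_all2 (\<lambda>x n. x \<in> D n) xs ns" "list_all2 (\<lambda>x n. x \<in> D n) ys ns"
    "\<And>i. i < arity L B \<Longrightarrow> \<delta> (xs ! i) (ys ! i) < modulus L B ns \<epsilon>"
  shows "\<bar>R B xs - R B ys\<bar> \<le> \<epsilon>"
  using assms unfolding respects_moduli_def by blast

lemma modulus_pos:
  "countable_language L \<Longrightarrow> B \<in> symbols L \<Longrightarrow> length ns = arity L B \<Longrightarrow> \<epsilon> > 0 \<Longrightarrow> modulus L B ns \<epsilon> > 0"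
  unfolding countable_language_def by blast

text \<open>The witness \<open>e\<close> of \<open>coded_by\<close> becomes a parameter, so that one
  dense sequence serves all arguments about a coded structure.\<close>

locale presented =
  fixes L :: "'s language" and Q :: "nat \<Rightarrow> nat set" and f :: "'s \<Rightarrow> nat list \<Rightarrow> real"
    and M :: "('a, 's) mstructure" and e :: "nat \<Rightarrow> 'a"
  assumes language: "countable_language L"
    and filtration: "admissible_filtration Q"
    and structure_M: "is_structure L M"
    and e_in: "range e \<subseteq> mspace (support M)"
    and dist_e: "\<And>m n. mdist (support M) (e m) (e n) = code_dist L f m n"
    and dense: "mtopology_of (support M) closure_of range e = mspace (support M)"
    and domain_eq: "\<And>n. domain M n = mtopology_of (support M) closure_of (e ` Q n)"
    and interp_e: "\<And>B ms. B \<in> symbols L \<Longrightarrow> ms \<in> tuples UNIV (arity L B) \<Longrightarrow> interp M B (map e ms) = f B ms"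
    and off_domain: "\<And>B xs. B \<in> symbols L \<Longrightarrow> xs \<in> tuples (mspace (support M)) (arity L B) \<Longrightarrow>
      \<nexists>n. set xs \<subseteq> domain M n \<Longrightarrow>
        if \<exists>r. dense_limit L f (support M) e B xs r
        then dense_limit L f (support M) e B xs (interp M B xs)
        else interp M B xs = 0"

lemma coded_by_iff_presented:
  assumes "countable_language L" "admissible_filtration Q"
  shows "coded_by L Q f M \<longleftrightarrow> (\<exists>e. presented L Q f M e)"
  using assms unfolding coded_by_def presented_def by blast

context presented
begin

abbreviation "S \<equiv> mspace (support M)"
abbreviation "\<delta> \<equiv> mdist (support M)"
abbreviation "D \<equiv> domain M"

sublocale Metric_space S \<delta> by (rule Metric_space_mspace_mdist)

lemma mtopology_of_support: "mtopology_of (support M) = mtopology"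
  by (simp add: mtopology_of_def)

lemma e_in_S: "e i \<in> S"
  using e_in by blast

lemma domain_subset: "D n \<subseteq> S"
  using closure_of_subset_topspace[of "mtopology_of (support M)"] by (simp add: domain_eq)

lemma domain_mono: "m \<le> n \<Longrightarrow> D m \<subseteq> D n"
  unfolding domain_eq by (intro closure_of_mono image_mono admissible_mono filtration)

lemma e_in_domain: "i \<in> Q n \<Longrightarrow> e i \<in> D n"
  unfolding domain_eq
  by (rule subsetD[OF closure_of_subset]) (use e_in in auto)

lemma e_in_domain_rank: "e i \<in> D (rank Q i)"
  by (intro e_in_domain in_rank filtration)

lemma complete: "mcomplete_of (support M)"
  using structure_M by (simp add: is_structure_def)

lemma closed_domain: "closedin mtopology (D n)"
  by (simp add: domain_eq mtopology_of_support)

lemma dist_symbol: "dist_symbol L \<in> symbols L" "arity L (dist_symbol L) = 2"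
  using language by (auto simp: countable_language_def)

lemma interp_dist: "x \<in> S \<Longrightarrow> y \<in> S \<Longrightarrow> interp M (dist_symbol L) [x, y] = \<delta> x y"
  using structure_M by (simp add: is_structure_def)

text \<open>Moduli may depend on the domains, so continuity is claimed only when one list
  \<open>ns\<close> of domains confines both the limit tuple and the whole sequence.\<close>

lemma interp_tendsto:
  assumes B: "B \<in> symbols L" and ns: "length ns = arity L B"
    and xs: "list_all2 (\<lambda>x n. x \<in> D n) xs ns"
    and ys: "\<And>j. list_all2 (\<lambda>x n. x \<in> D n) (ys j) ns"
    and lim: "\<And>i. i < arity L B \<Longrightarrow> (\<lambda>j. \<delta> (ys j ! i) (xs ! i)) \<longlonglongrightarrow> 0"
  shows "(\<lambda>j. interp M B (ys j)) \<longlonglongrightarrow> interp M B xs"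
proof (rule tendstoI)
  fix r :: real assume r: "r > 0"
  have pos: "modulus L B ns (r/2) > 0"
    by (rule modulus_pos) (use language B ns r in auto)
  have "\<forall>\<^sub>F j in sequentially. \<forall>i\<in>{..<arity L B}. \<delta> (ys j ! i) (xs ! i) < modulus L B ns (r/2)"
    by (intro eventually_ball_finite ballI order_tendstoD(2)[OF lim pos]) auto
  then show "\<forall>\<^sub>F j in sequentially. dist (interp M B (ys j)) (interp M B xs) < r"
  proof eventually_elim
    case (elim j)
    have "\<bar>interp M B (ys j) - interp M B xs\<bar> \<le> r/2"
      by (rule respects_moduliD[of L D \<delta>])
         (use structure_M B ns r ys xs elim in \<open>auto simp: is_structure_def\<close>)
    then show ?case using r by (simp add: dist_real_def)
  qed
qed

text \<open>Since \<open>D n\<close> is the closure of the codes from \<open>Q n\<close>, the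
  approximating codes can be taken in the same product of domains as \<open>xs\<close>, where
  \<open>interp_tendsto\<close> applies.\<close>

lemma approximating_codes:
  assumes B: "B \<in> symbols L" and ns: "length ns = arity L B"
    and xs: "list_all2 (\<lambda>x n. x \<in> D n) xs ns"
  obtains q where "\<And>j::nat. list_all2 (\<lambda>m n. m \<in> Q n) (q j) ns"
    "\<And>i. i < arity L B \<Longrightarrow> (\<lambda>j. \<delta> (e (q j ! i)) (xs ! i)) \<longlonglongrightarrow> 0"
    "(\<lambda>j. f B (q j)) \<longlonglongrightarrow> interp M B xs"
proof -
  have len: "length xs = length ns" using xs by (rule list_all2_lengthD)
  obtain q where q: "\<And>j::nat. length (q j) = length xs" "\<And>i j. i < length xs \<Longrightarrow> q j ! i \<in> Q (ns ! i)"
    "\<And>i. i < length xs \<Longrightarrow> (\<lambda>j. \<delta> (e (q j ! i)) (xs ! i)) \<longlonglongrightarrow> 0"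
    by (rule closure_of_dense_tuples[of xs e "\<lambda>i. Q (ns ! i)"])
       (use xs e_in in \<open>auto simp: mtopology_of_support domain_eq list_all2_conv_all_nth\<close>)
  have qQ: "list_all2 (\<lambda>m n. m \<in> Q n) (q j) ns" for j
    using q len by (simp add: list_all2_conv_all_nth)
  have "(\<lambda>j. interp M B (map e (q j))) \<longlonglongrightarrow> interp M B xs"
    by (rule interp_tendsto[OF B ns xs])
       (use q len ns e_in_domain in \<open>auto simp: list_all2_conv_all_nth\<close>)
  moreover have "interp M B (map e (q j)) = f B (q j)" for j
    by (rule interp_e[OF B]) (use q len ns in \<open>auto simp: tuples_def\<close>)
  ultimately show thesis
    using that[of q] qQ q(3) len ns by simp
qed

lemma approximating_code:
  assumes B: "B \<in> symbols L" and ns: "length ns = arity L B"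
    and xs: "list_all2 (\<lambda>x n. x \<in> D n) xs ns" and "\<epsilon> > 0"
  obtains q where "list_all2 (\<lambda>m n. m \<in> Q n) q ns"
    "\<And>i. i < arity L B \<Longrightarrow> \<delta> (e (q ! i)) (xs ! i) < \<epsilon>" "\<bar>f B q - interp M B xs\<bar> < \<epsilon>"
proof -
  obtain q where q: "\<And>j::nat. list_all2 (\<lambda>m n. m \<in> Q n) (q j) ns"
    "\<And>i. i < arity L B \<Longrightarrow> (\<lambda>j. \<delta> (e (q j ! i)) (xs ! i)) \<longlonglongrightarrow> 0"
    "(\<lambda>j. f B (q j)) \<longlonglongrightarrow> interp M B xs"
    using approximating_codes[OF B ns xs] by blast
  have "\<forall>\<^sub>F j in sequentially. \<forall>i\<in>{..<arity L B}. \<delta> (e (q j ! i)) (xs ! i) < \<epsilon>"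
    by (intro eventually_ball_finite ballI order_tendstoD(2)[OF q(2) \<open>\<epsilon> > 0\<close>]) auto
  moreover have "\<forall>\<^sub>F j in sequentially. dist (f B (q j)) (interp M B xs) < \<epsilon>"
    using tendstoD[OF q(3) \<open>\<epsilon> > 0\<close>] .
  ultimately have "\<forall>\<^sub>F j in sequentially.
      (\<forall>i\<in>{..<arity L B}. \<delta> (e (q j ! i)) (xs ! i) < \<epsilon>) \<and> dist (f B (q j)) (interp M B xs) < \<epsilon>"
    by (rule eventually_conj)
  then obtain j where "\<forall>i\<in>{..<arity L B}. \<delta> (e (q j ! i)) (xs ! i) < \<epsilon>"
    "dist (f B (q j)) (interp M B xs) < \<epsilon>"
    using eventually_happens'[OF sequentially_bot] by blast
  then show thesis
    using that[of "q j"] q(1) by (simp add: dist_real_def)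
qed

lemma domain_replicate:
  "length xs = k \<Longrightarrow> set xs \<subseteq> D n \<Longrightarrow> list_all2 (\<lambda>x n. x \<in> D n) xs (replicate k n)"
  by (auto simp: list_all2_conv_all_nth)

lemma code_in_domain: "\<exists>n. set q \<subseteq> Q n"
proof (induction q)
  case (Cons i q)
  then obtain n where "set q \<subseteq> Q n" by blast
  then have "set (i # q) \<subseteq> Q (max n (rank Q i))"
    using in_rank[OF filtration, of i] admissible_mono[OF filtration, of n "max n (rank Q i)"]
      admissible_mono[OF filtration, of "rank Q i" "max n (rank Q i)"] by auto
  then show ?case by blast
qed simp

end

section \<open>Embeddings between two presented structures\<close>

locale two_presented = A: presented L Q f M e + B: presented L Q f' M' e'
  for L :: "'s language" and Q f f' and M :: "('a, 's) mstructure" and e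
    and M' :: "('b, 's) mstructure" and e'
begin

text \<open>Values are compared only on tuples inside one domain. On other tuples they follow the
  \<open>dense_limit\<close> convention of the coding, and agreement there is derived later for
  surjective embeddings.\<close>

definition embedding :: "('a \<Rightarrow> 'b) \<Rightarrow> bool" where
  "embedding \<phi> \<longleftrightarrow> \<phi> \<in> A.S \<rightarrow> B.S \<and> (\<forall>x\<in>A.S. \<forall>y\<in>A.S. B.\<delta> (\<phi> x) (\<phi> y) = A.\<delta> x y) \<and>
     (\<forall>n. \<phi> ` A.D n \<subseteq> B.D n) \<and>
     (\<forall>B\<in>symbols L. \<forall>xs n. length xs = arity L B \<and> set xs \<subseteq> A.D n \<longrightarrow>
        interp M' B (map \<phi> xs) = interp M B xs)"

text \<open>Codes \<open>q j\<close> tending to \<open>xs\<close> are shadowed by codes of the other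
  structure: the image of \<open>e (q j)\<close> lies in a domain, so some \<open>p j\<close> is
  within \<open>1/(j+1)\<close> of it both in distance and in value. Then \<open>p j\<close> tends
  to \<open>map \<phi> xs\<close>, and its values differ from those of \<open>q j\<close> by a null
  sequence.\<close>

lemma dense_limit_reflects:
  assumes \<phi>: "embedding \<phi>" and B: "B \<in> symbols L" and xs: "xs \<in> tuples A.S (arity L B)"
    and lim: "dense_limit L f' (support M') e' B (map \<phi> xs) r"
  shows "dense_limit L f (support M) e B xs r"
  unfolding dense_limit_def
proof (intro allI impI, elim conjE)
  fix q assume q: "\<forall>j. q j \<in> tuples UNIV (arity L B)"
    and conv: "\<forall>i<arity L B. (\<lambda>j. A.\<delta> (e (q j ! i)) (xs ! i)) \<longlonglongrightarrow> 0"
  have len: "length (q j) = arity L B" "length xs = arity L B" for j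
    using q xs by (auto simp: tuples_def)
  have xsS: "xs ! i \<in> A.S" if "i < arity L B" for i
    using xs that by (auto simp: tuples_def)
  have "\<exists>p. length p = arity L B \<and> (\<forall>i<arity L B. B.\<delta> (e' (p ! i)) (\<phi> (e (q j ! i))) < inverse (real (Suc j)))
      \<and> \<bar>f' B p - f B (q j)\<bar> < inverse (real (Suc j))" for j
  proof -
    obtain n where n: "set (q j) \<subseteq> Q n" using A.code_in_domain by blast
    then have D: "set (map e (q j)) \<subseteq> A.D n" using A.e_in_domain by auto
    then have "set (map \<phi> (map e (q j))) \<subseteq> B.D n"
      using \<phi> unfolding embedding_def set_map[of \<phi>] by (meson image_mono order_trans)
    then have la: "list_all2 (\<lambda>x n. x \<in> B.D n) (map \<phi> (map e (q j))) (replicate (arity L B) n)"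
      by (intro B.domain_replicate) (use len in auto)
    obtain p where "list_all2 (\<lambda>m n. m \<in> Q n) p (replicate (arity L B) n)"
      "\<And>i. i < arity L B \<Longrightarrow> B.\<delta> (e' (p ! i)) (map \<phi> (map e (q j)) ! i) < inverse (real (Suc j))"
      "\<bar>f' B p - interp M' B (map \<phi> (map e (q j)))\<bar> < inverse (real (Suc j))"
      using B.approximating_code[OF B _ la, of "inverse (real (Suc j))"] by auto
    moreover have "interp M' B (map \<phi> (map e (q j))) = interp M B (map e (q j))"
      using \<phi> B D len unfolding embedding_def by (metis length_map)
    moreover have "interp M B (map e (q j)) = f B (q j)"
      using A.interp_e B q by blast
    ultimately show ?thesis
      using len by (intro exI[of _ p]) (auto dest: list_all2_lengthD)
  qed
  then obtain p where p: "\<And>j. length (p j) = arity L B"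
    "\<And>i j. i < arity L B \<Longrightarrow> B.\<delta> (e' (p j ! i)) (\<phi> (e (q j ! i))) < inverse (real (Suc j))"
    "\<And>j. \<bar>f' B (p j) - f B (q j)\<bar> < inverse (real (Suc j))"
    by metis
  have "(\<lambda>j. f' B (p j)) \<longlonglongrightarrow> r"
  proof (rule lim[unfolded dense_limit_def, rule_format], intro conjI allI impI)
    fix i assume i: "i < arity L B"
    show "(\<lambda>j. B.\<delta> (e' (p j ! i)) (map \<phi> xs ! i)) \<longlonglongrightarrow> 0"
    proof (rule Lim_null_comparison)
      have "B.\<delta> (e' (p j ! i)) (\<phi> (xs ! i)) \<le> inverse (real (Suc j)) + A.\<delta> (e (q j ! i)) (xs ! i)" for j
      proof -
        have "B.\<delta> (\<phi> (e (q j ! i))) (\<phi> (xs ! i)) = A.\<delta> (e (q j ! i)) (xs ! i)"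
          and "\<phi> (e (q j ! i)) \<in> B.S" "\<phi> (xs ! i) \<in> B.S"
          using \<phi> xsS[OF i] A.e_in_S by (auto simp: embedding_def)
        then show ?thesis
          using B.triangle[of "e' (p j ! i)" "\<phi> (e (q j ! i))" "\<phi> (xs ! i)"] p(2)[OF i, of j] B.e_in_S
          by fastforce
      qed
      then show "\<forall>\<^sub>F j in sequentially. norm (B.\<delta> (e' (p j ! i)) (map \<phi> xs ! i))
          \<le> inverse (real (Suc j)) + A.\<delta> (e (q j ! i)) (xs ! i)"
        using i len by simp
      show "(\<lambda>j. inverse (real (Suc j)) + A.\<delta> (e (q j ! i)) (xs ! i)) \<longlonglongrightarrow> 0"
        using tendsto_add[OF LIMSEQ_inverse_real_of_nat conv[rule_format, OF i]] by simp
    qed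
  qed (use p in \<open>simp add: tuples_def\<close>)
  moreover have "(\<lambda>j. f' B (p j) - f B (q j)) \<longlonglongrightarrow> 0"
    by (rule Lim_null_comparison[OF _ LIMSEQ_inverse_real_of_nat])
       (use p(3) in \<open>auto intro!: always_eventually less_imp_le\<close>)
  ultimately have "(\<lambda>j. f' B (p j) - (f' B (p j) - f B (q j))) \<longlonglongrightarrow> r - 0"
    by (rule tendsto_diff)
  then show "(\<lambda>j. f B (q j)) \<longlonglongrightarrow> r" by simp
qed

text \<open>A sequence with the same relation values as the codes extends to an isometry. Domains
  are mapped into domains because they are closed and contain the relevant \<open>y i\<close>;
  values agree by continuity along codes from one domain.\<close>

lemma embeddingI:
  assumes y: "\<And>i. y i \<in> B.D (rank Q i)"
    and interp_y: "\<And>B s. B \<in> symbols L \<Longrightarrow> s \<in> tuples UNIV (arity L B) \<Longrightarrow> interp M' B (map y s) = f B s"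
  shows "\<exists>\<phi>. embedding \<phi>"
proof -
  have yS: "y i \<in> B.S" for i using y B.domain_subset by blast
  have yQ: "y i \<in> B.D n" if "i \<in> Q n" for i n
    using y[of i] B.domain_mono[OF rank_le, of i Q n] that by blast
  \<comment> \<open>The metric is itself a relation symbol, so \<open>interp_y\<close> contains the
    isometry condition.\<close>
  have "B.\<delta> (y i) (y j) = A.\<delta> (e i) (e j)" for i j
    using interp_y[of "dist_symbol L" "[i, j]"] A.dist_symbol B.interp_dist[OF yS yS, of i j] A.dist_e[of i j]
    by (simp add: tuples_def code_dist_def)
  then obtain \<phi> where \<phi>: "\<phi> \<in> A.S \<rightarrow> B.S" "\<And>i. \<phi> (e i) = y i"
    and iso: "\<And>a b. a \<in> A.S \<Longrightarrow> b \<in> A.S \<Longrightarrow> B.\<delta> (\<phi> a) (\<phi> b) = A.\<delta> a b"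
    using isometry_extends[OF B.complete A.e_in A.dense, of y] yS by blast
  have lim: "(\<lambda>j. B.\<delta> (y (m j)) (\<phi> x)) \<longlonglongrightarrow> 0"
    if "(\<lambda>j. A.\<delta> (e (m j)) x) \<longlonglongrightarrow> 0" "x \<in> A.S" for m x
    using that iso[of "e (m _)" x] A.e_in_S by (simp add: \<phi>(2))
  have dom: "\<phi> x \<in> B.D n" if x: "x \<in> A.D n" for x n
  proof -
    have xS: "x \<in> A.S" using x A.domain_subset by blast
    obtain m where m: "\<And>j::nat. m j \<in> Q n" "(\<lambda>j. A.\<delta> (e (m j)) x) \<longlonglongrightarrow> 0"
      using A.closure_of_dense_sequence[of x e "Q n"] x A.e_in
      by (auto simp: A.domain_eq A.mtopology_of_support)
    have "limitin B.mtopology (\<lambda>j. y (m j)) (\<phi> x) sequentially"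
      using lim[OF m(2) xS] xS \<phi>(1) yS by (auto simp: B.limitin_metric_dist_null)
    then show ?thesis
      by (rule limitin_closedin[OF _ B.closed_domain]) (use yQ m in auto)
  qed
  have "interp M' B (map \<phi> xs) = interp M B xs"
    if B: "B \<in> symbols L" and len: "length xs = arity L B" and xs: "set xs \<subseteq> A.D n" for B xs n
  proof -
    let ?ns = "replicate (arity L B) n"
    obtain q where q: "\<And>j::nat. list_all2 (\<lambda>m n. m \<in> Q n) (q j) ?ns"
      "\<And>i. i < arity L B \<Longrightarrow> (\<lambda>j. A.\<delta> (e (q j ! i)) (xs ! i)) \<longlonglongrightarrow> 0"
      "(\<lambda>j. f B (q j)) \<longlonglongrightarrow> interp M B xs"
      using A.approximating_codes[OF B _ A.domain_replicate[OF len xs]] by auto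
    have ql: "length (q j) = arity L B" "\<And>i. i < arity L B \<Longrightarrow> q j ! i \<in> Q n" for j
      using q(1)[of j] by (auto simp: list_all2_conv_all_nth)
    have "(\<lambda>j. interp M' B (map y (q j))) \<longlonglongrightarrow> interp M' B (map \<phi> xs)"
    proof (rule B.interp_tendsto[OF B, of ?ns])
      show "list_all2 (\<lambda>x n. x \<in> B.D n) (map \<phi> xs) ?ns"
        by (rule B.domain_replicate) (use len xs dom in auto)
      show "list_all2 (\<lambda>x n. x \<in> B.D n) (map y (q j)) ?ns" for j
        using ql yQ by (simp add: list_all2_conv_all_nth)
      show "(\<lambda>j. B.\<delta> (map y (q j) ! i) (map \<phi> xs ! i)) \<longlonglongrightarrow> 0" if i: "i < arity L B" for i
      proof -
        have "xs ! i \<in> set xs" using i len by simp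
        then have "xs ! i \<in> A.S" using xs A.domain_subset by blast
        then show ?thesis using lim[OF q(2)[OF i]] i len ql by simp
      qed
    qed simp
    moreover have "interp M' B (map y (q j)) = f B (q j)" for j
      using interp_y B ql by (simp add: tuples_def)
    ultimately show ?thesis
      using LIMSEQ_unique[OF q(3)] by simp
  qed
  then have "embedding \<phi>"
    unfolding embedding_def using \<phi>(1) iso dom by blast
  then show ?thesis by blast
qed

end

section \<open>Embeddings and the invariant\<close>

lemma isomorphic_structuresE:
  assumes "isomorphic_structures L M N"
  obtains \<phi> where "bij_betw \<phi> (mspace (support M)) (mspace (support N))"
    "\<And>x y. x \<in> mspace (support M) \<Longrightarrow> y \<in> mspace (support M) \<Longrightarrow>
      mdist (support N) (\<phi> x) (\<phi> y) = mdist (support M) x y"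
    "\<And>n. \<phi> ` domain M n = domain N n"
    "\<And>B xs. B \<in> symbols L \<Longrightarrow> xs \<in> tuples (mspace (support M)) (arity L B) \<Longrightarrow>
      interp N B (map \<phi> xs) = interp M B xs"
  using assms unfolding isomorphic_structures_def
  by (elim exE conjE) (rule that; (assumption | blast))

lemma isomorphic_structures_sym:
  assumes iso: "isomorphic_structures L M N"
    and dom: "\<And>n. domain M n \<subseteq> mspace (support M)"
  shows "isomorphic_structures L N M"
proof -
  obtain \<phi> where bij: "bij_betw \<phi> (mspace (support M)) (mspace (support N))"
    and dist: "\<And>x y. x \<in> mspace (support M) \<Longrightarrow> y \<in> mspace (support M) \<Longrightarrow>
      mdist (support N) (\<phi> x) (\<phi> y) = mdist (support M) x y"
    and domeq: "\<And>n. \<phi> ` domain M n = domain N n"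
    and int: "\<And>B xs. B \<in> symbols L \<Longrightarrow> xs \<in> tuples (mspace (support M)) (arity L B) \<Longrightarrow>
      interp N B (map \<phi> xs) = interp M B xs"
    using isomorphic_structuresE[OF iso] by metis
  define \<psi> where "\<psi> = inv_into (mspace (support M)) \<phi>"
  have bij': "bij_betw \<psi> (mspace (support N)) (mspace (support M))"
    unfolding \<psi>_def by (rule bij_betw_inv_into[OF bij])
  have inv: "\<phi> (\<psi> z) = z" if "z \<in> mspace (support N)" for z
    unfolding \<psi>_def using bij_betw_inv_into_right[OF bij that] .
  have inv': "\<psi> (\<phi> x) = x" if "x \<in> mspace (support M)" for x
    unfolding \<psi>_def using bij_betw_inv_into_left[OF bij that] .
  have \<psi>: "\<psi> z \<in> mspace (support M)" if "z \<in> mspace (support N)" for z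
    using bij' that by (auto simp: bij_betw_def)
  have "mdist (support M) (\<psi> x) (\<psi> y) = mdist (support N) x y"
    if "x \<in> mspace (support N)" "y \<in> mspace (support N)" for x y
    using dist[of "\<psi> x" "\<psi> y"] inv \<psi> that by simp
  moreover have "\<psi> ` domain N n = domain M n" for n
  proof -
    have "(\<lambda>x. \<psi> (\<phi> x)) ` domain M n = (\<lambda>x. x) ` domain M n"
      by (rule image_cong[OF refl], rule inv') (use dom in blast)
    then show ?thesis by (simp add: domeq[symmetric] image_image)
  qed
  moreover have "interp M B (map \<psi> xs) = interp N B xs"
    if B: "B \<in> symbols L" and xs: "xs \<in> tuples (mspace (support N)) (arity L B)" for B xs
  proof -
    have "map \<phi> (map \<psi> xs) = xs"
      using xs inv by (auto simp: tuples_def subset_iff intro: map_idI)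
    moreover have "map \<psi> xs \<in> tuples (mspace (support M)) (arity L B)"
      using xs \<psi> by (auto simp: tuples_def)
    ultimately show ?thesis using int[OF B, of "map \<psi> xs"] by simp
  qed
  ultimately show ?thesis
    unfolding isomorphic_structures_def using bij' by blast
qed

context two_presented
begin

text \<open>Only tuples outside all domains need an argument. The inverse map is an embedding as
  well, so \<open>dense_limit_reflects\<close> applies in both directions: limits exist at
  \<open>xs\<close> and \<open>map \<phi> xs\<close> simultaneously and coincide, and if there is
  none both values are the default 0.\<close>

lemma embedding_isomorphic:
  assumes \<phi>: "embedding \<phi>" and surj: "\<phi> ` A.S = B.S" and dom: "\<And>n. \<phi> ` A.D n = B.D n"
  shows "isomorphic_structures L M M'"
proof -
  interpret C: two_presented L Q f' f M' e' M e ..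
  have into: "\<And>x. x \<in> A.S \<Longrightarrow> \<phi> x \<in> B.S"
    and iso: "\<And>x y. x \<in> A.S \<Longrightarrow> y \<in> A.S \<Longrightarrow> B.\<delta> (\<phi> x) (\<phi> y) = A.\<delta> x y"
    and int: "\<And>B xs n. B \<in> symbols L \<Longrightarrow> length xs = arity L B \<Longrightarrow> set xs \<subseteq> A.D n \<Longrightarrow>
      interp M' B (map \<phi> xs) = interp M B xs"
    using \<phi> unfolding embedding_def by blast+
  have inj: "inj_on \<phi> A.S"
  proof (rule inj_onI)
    fix x y assume xy: "x \<in> A.S" "y \<in> A.S" "\<phi> x = \<phi> y"
    then have "A.\<delta> x y = 0"
      using iso[of x y] into by simp
    then show "x = y" using xy by simp
  qed
  define \<psi> where "\<psi> = inv_into A.S \<phi>"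
  have inv: "\<phi> (\<psi> z) = z" "\<psi> z \<in> A.S" if "z \<in> B.S" for z
    using that surj by (auto simp: \<psi>_def f_inv_into_f inv_into_into)
  have inv': "\<psi> (\<phi> x) = x" if "x \<in> A.S" for x
    using inj that by (simp add: \<psi>_def)
  have \<psi>D: "\<psi> z \<in> A.D n" if "z \<in> B.D n" for z n
  proof -
    have "z \<in> \<phi> ` A.D n" using that by (simp only: dom)
    then obtain x where "z = \<phi> x" "x \<in> A.D n" by (rule imageE)
    then show ?thesis using inv'[OF subsetD[OF A.domain_subset]] by simp
  qed
  have embedding_inv: "C.embedding \<psi>"
    unfolding C.embedding_def
  proof (intro conjI ballI allI impI)
    show "\<psi> \<in> B.S \<rightarrow> A.S" using inv by blast
    show "A.\<delta> (\<psi> x) (\<psi> y) = B.\<delta> x y" if "x \<in> B.S" "y \<in> B.S" for x y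
      using iso[of "\<psi> x" "\<psi> y"] inv that by simp
    show "\<psi> ` B.D n \<subseteq> A.D n" for n using \<psi>D by blast
    fix B ys n assume B: "B \<in> symbols L" and ys: "length ys = arity L B \<and> set ys \<subseteq> B.D n"
    have "map \<phi> (map \<psi> ys) = ys"
      using ys inv B.domain_subset[of n] by (auto simp: subset_iff intro: map_idI)
    moreover have "set (map \<psi> ys) \<subseteq> A.D n" using ys \<psi>D by auto
    ultimately show "interp M B (map \<psi> ys) = interp M' B ys"
      using int[OF B, of "map \<psi> ys"] ys by simp
  qed
  have "interp M' B (map \<phi> xs) = interp M B xs"
    if B: "B \<in> symbols L" and xs: "xs \<in> tuples A.S (arity L B)" for B xs
  proof (cases "\<exists>n. set xs \<subseteq> A.D n")
    case True
    then show ?thesis using int[OF B] xs by (auto simp: tuples_def)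
  next
    case False
    have \<phi>xs: "map \<phi> xs \<in> tuples B.S (arity L B)"
      using xs into by (auto simp: tuples_def)
    have \<psi>\<phi>: "map \<psi> (map \<phi> xs) = xs"
      using xs inv' by (auto simp: tuples_def subset_iff intro: map_idI)
    have "set xs \<subseteq> A.D n" if "set (map \<phi> xs) \<subseteq> B.D n" for n
    proof -
      have "set (map \<psi> (map \<phi> xs)) \<subseteq> A.D n" using that \<psi>D by auto
      then show ?thesis by (simp only: \<psi>\<phi>)
    qed
    then have False': "\<nexists>n. set (map \<phi> xs) \<subseteq> B.D n" using False by blast
    have iff: "dense_limit L f' (support M') e' B (map \<phi> xs) r \<longleftrightarrow>
        dense_limit L f (support M) e B xs r" for r
    proof
      show "dense_limit L f (support M) e B xs r"
        if "dense_limit L f' (support M') e' B (map \<phi> xs) r"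
        by (rule dense_limit_reflects[OF \<phi> B xs that])
      show "dense_limit L f' (support M') e' B (map \<phi> xs) r"
        if "dense_limit L f (support M) e B xs r"
        by (rule C.dense_limit_reflects[OF embedding_inv B \<phi>xs]) (use that in \<open>simp only: \<psi>\<phi>\<close>)
    qed
    show ?thesis
    proof (cases "\<exists>r. dense_limit L f (support M) e B xs r")
      case True
      then have "dense_limit L f (support M) e B xs (interp M B xs)"
        using A.off_domain[OF B xs False] by simp
      moreover have "dense_limit L f (support M) e B xs (interp M' B (map \<phi> xs))"
        using B.off_domain[OF B \<phi>xs False'] True unfolding iff by simp
      ultimately show ?thesis
        using dense_limit_unique[OF A.e_in A.dense xs] by blast
    next
      case no: False
      then show ?thesis
        using A.off_domain[OF B xs False] B.off_domain[OF B \<phi>xs False'] unfolding iff by simp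
    qed
  qed
  then show ?thesis
    unfolding isomorphic_structures_def bij_betw_def using inj surj iso dom by blast
qed

text \<open>The composite \<open>\<phi> \<circ> \<psi>\<close> maps each compact domain of
  \<open>M'\<close> isometrically into itself, hence onto itself; therefore \<open>\<phi>\<close>
  maps domains onto domains.\<close>

lemma mutual_embeddings_isomorphic:
  assumes \<phi>: "embedding \<phi>" and \<psi>: "two_presented.embedding L M' M \<psi>"
    and proper: "\<And>n. compactin B.mtopology (B.D n)"
  shows "isomorphic_structures L M M'"
proof -
  interpret C: two_presented L Q f' f M' e' M e ..
  have \<phi>into: "\<And>x. x \<in> A.S \<Longrightarrow> \<phi> x \<in> B.S"
    and \<phi>iso: "\<And>x y. x \<in> A.S \<Longrightarrow> y \<in> A.S \<Longrightarrow> B.\<delta> (\<phi> x) (\<phi> y) = A.\<delta> x y"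
    and \<phi>dom: "\<And>n. \<phi> ` A.D n \<subseteq> B.D n"
    using \<phi> unfolding embedding_def by blast+
  have \<psi>into: "\<And>x. x \<in> B.S \<Longrightarrow> \<psi> x \<in> A.S"
    and \<psi>iso: "\<And>x y. x \<in> B.S \<Longrightarrow> y \<in> B.S \<Longrightarrow> A.\<delta> (\<psi> x) (\<psi> y) = B.\<delta> x y"
    and \<psi>dom: "\<And>n. \<psi> ` B.D n \<subseteq> A.D n"
    using \<psi> unfolding C.embedding_def by blast+
  have dom: "\<phi> ` A.D n = B.D n" for n
  proof
    have "(\<phi> \<circ> \<psi>) ` B.D n = B.D n"
    proof (rule B.isometry_of_compact_surj[OF proper])
      show "(\<phi> \<circ> \<psi>) ` B.D n \<subseteq> B.D n"
        using \<phi>dom[of n] \<psi>dom[of n] by auto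
      show "B.\<delta> ((\<phi> \<circ> \<psi>) x) ((\<phi> \<circ> \<psi>) y) = B.\<delta> x y" if "x \<in> B.D n" "y \<in> B.D n" for x y
        using that B.domain_subset[of n] by (simp add: \<phi>iso \<psi>iso \<psi>into subset_iff)
    qed
    then show "B.D n \<subseteq> \<phi> ` A.D n"
      using \<psi>dom[of n] by (auto simp: image_comp[symmetric])
  qed (rule \<phi>dom)
  \<comment> \<open>The domains may fail to cover the support, so surjectivity on the support is
    proved separately. The codes of \<open>M'\<close> lie in domains and have preimages; the
    isometric assignment of these preimages extends to a right inverse \<open>\<theta>\<close> of
    \<open>\<phi>\<close>, as \<open>M\<close> is complete.\<close>
  have "\<exists>x. x \<in> A.S \<and> \<phi> x = e' i" for i
    using dom[of "rank Q i"] B.e_in_domain_rank[of i] A.domain_subset[of "rank Q i"]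
    by (metis imageE subsetD)
  then obtain x where x: "\<And>i. x i \<in> A.S" "\<And>i. \<phi> (x i) = e' i" by metis
  have "A.\<delta> (x i) (x j) = B.\<delta> (e' i) (e' j)" for i j
    using \<phi>iso[of "x i" "x j"] x by simp
  then obtain \<theta> where \<theta>: "\<theta> \<in> B.S \<rightarrow> A.S" "\<And>i. \<theta> (e' i) = x i"
    and \<theta>iso: "\<And>a b. a \<in> B.S \<Longrightarrow> b \<in> B.S \<Longrightarrow> A.\<delta> (\<theta> a) (\<theta> b) = B.\<delta> a b"
    using isometry_extends[OF A.complete B.e_in B.dense, of x] x(1) by blast
  have "z \<in> \<phi> ` A.S" if z: "z \<in> B.S" for z
  proof -
    obtain u where u: "(\<lambda>j. B.\<delta> (e' (u j)) z) \<longlonglongrightarrow> 0"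
      using B.closure_of_dense_sequence[of z e' UNIV] z B.dense B.e_in
      by (metis B.mtopology_of_support)
    have \<theta>z: "\<theta> z \<in> A.S" using \<theta>(1) z by blast
    have "B.\<delta> (e' (u j)) (\<phi> (\<theta> z)) = B.\<delta> (e' (u j)) z" for j
      using \<phi>iso[OF x(1) \<theta>z, of "u j"] \<theta>iso[OF B.e_in_S z, of "u j"] by (simp add: x(2) \<theta>(2))
    then have "(\<lambda>j. B.\<delta> (e' (u j)) (\<phi> (\<theta> z))) \<longlonglongrightarrow> 0"
      using u by simp
    then have "\<phi> (\<theta> z) = z"
      using u z \<phi>into[OF \<theta>z] B.e_in_S
      by (intro B.limitin_metric_unique[of "\<lambda>j. e' (u j)" _ sequentially])
         (auto simp: B.limitin_metric_dist_null)
    then show ?thesis using \<theta>z by (metis image_eqI)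
  qed
  then have "\<phi> ` A.S = B.S" using \<phi>into by blast
  then show ?thesis
    using embedding_isomorphic[OF \<phi> _ dom] by blast
qed

end

text \<open>
  Conditions on the values of the relations are tested on tuples of codes: since they are open, it
  is the same to ask for a tuple from the domains.
\<close>

definition symbol_at :: "'s language \<Rightarrow> nat \<Rightarrow> 's" where
  "symbol_at L = from_nat_into (symbols L)"

text \<open>A condition \<open>(j, s, a, b)\<close> puts the value of the \<open>j\<close>-th
  symbol, at the entries of \<open>ys\<close> selected by the index list \<open>s\<close>, into a
  rational interval. An ill-formed \<open>s\<close> makes the condition fail for every code
  alike.\<close>

definition realized ::
  "'s language \<Rightarrow> (nat \<Rightarrow> nat set) \<Rightarrow> ('s \<Rightarrow> nat list \<Rightarrow> real) \<Rightarrow> nat \<Rightarrow>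
     (nat \<times> nat list \<times> rat \<times> rat) list \<Rightarrow> bool" where
  "realized L Q f m cs \<longleftrightarrow>
     (\<exists>ys. length ys = m \<and> (\<forall>i<m. ys ! i \<in> Q (rank Q i)) \<and>
        (\<forall>(j, s, a, b)\<in>set cs. s \<in> tuples {..<m} (arity L (symbol_at L j)) \<and>
           of_rat a < f (symbol_at L j) (map ((!) ys) s) \<and>
           f (symbol_at L j) (map ((!) ys) s) < of_rat b))"

text \<open>The characteristic function of the set of realized tests, read as a point of the
  countable power of the real line.\<close>

definition invariant ::
  "'s language \<Rightarrow> (nat \<Rightarrow> nat set) \<Rightarrow> ('s \<Rightarrow> nat list \<Rightarrow> real) \<Rightarrow> nat \<Rightarrow> real" where
  "invariant L Q f i = of_bool (case from_nat i of (m, cs) \<Rightarrow> realized L Q f m cs)"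

lemma invariant_eq_iff:
  "invariant L Q f = invariant L Q f' \<longleftrightarrow> (\<forall>m cs. realized L Q f m cs \<longleftrightarrow> realized L Q f' m cs)"
proof
  assume eq: "invariant L Q f = invariant L Q f'"
  show "\<forall>m cs. realized L Q f m cs \<longleftrightarrow> realized L Q f' m cs"
  proof (intro allI)
    fix m cs
    show "realized L Q f m cs \<longleftrightarrow> realized L Q f' m cs"
      using fun_cong[OF eq, of "to_nat (m, cs)"] by (simp add: invariant_def of_bool_eq_iff)
  qed
qed (simp add: invariant_def fun_eq_iff)

text \<open>The distance symbol makes the set of symbols nonempty; for a finite language the
  enumeration has repetitions.\<close>

lemma symbol_at_in: "countable_language L \<Longrightarrow> symbol_at L j \<in> symbols L"
  unfolding symbol_at_def countable_language_def by (metis empty_iff from_nat_into)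

lemma symbol_at_surj: "countable_language L \<Longrightarrow> B \<in> symbols L \<Longrightarrow> \<exists>j. B = symbol_at L j"
  unfolding symbol_at_def countable_language_def by (metis from_nat_into_surj)

section \<open>Isomorphism and equality of invariants\<close>

context two_presented
begin

text \<open>The isomorphism carries the witnessing codes to points \<open>z i\<close> of the domains
  of \<open>M'\<close> with the same values. These are approximated by codes in all coordinates at
  once, and finitely many strict inequalities persist near the limit.\<close>

lemma isomorphic_realized:
  assumes iso: "isomorphic_structures L M M'" and real: "realized L Q f m cs"
  shows "realized L Q f' m cs"
proof -
  obtain \<phi> where bij: "bij_betw \<phi> A.S B.S"
    and dom: "\<And>n. \<phi> ` A.D n = B.D n"
    and int: "\<And>B xs. B \<in> symbols L \<Longrightarrow> xs \<in> tuples A.S (arity L B) \<Longrightarrow>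
      interp M' B (map \<phi> xs) = interp M B xs"
    using isomorphic_structuresE[OF iso] by metis
  obtain ys where ys: "length ys = m" "\<And>i. i < m \<Longrightarrow> ys ! i \<in> Q (rank Q i)"
    and cs: "\<And>j s a b. (j, s, a, b) \<in> set cs \<Longrightarrow> s \<in> tuples {..<m} (arity L (symbol_at L j)) \<and>
           of_rat a < f (symbol_at L j) (map ((!) ys) s) \<and>
           f (symbol_at L j) (map ((!) ys) s) < of_rat b"
    using real unfolding realized_def by blast
  define z where "z i = \<phi> (e (ys ! i))" for i
  have z: "z i \<in> B.D (rank Q i)" if "i < m" for i
    unfolding z_def dom[symmetric] using A.e_in_domain[OF ys(2)[OF that]] by blast
  obtain q where q: "\<And>l::nat. length (q l) = m" "\<And>i l. i < m \<Longrightarrow> q l ! i \<in> Q (rank Q i)"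
    "\<And>i. i < m \<Longrightarrow> (\<lambda>l. B.\<delta> (e' (q l ! i)) (z i)) \<longlonglongrightarrow> 0"
    using B.closure_of_dense_tuples[of "map z [0..<m]" e' "\<lambda>i. Q (rank Q i)"] z B.e_in
    by (auto simp: B.domain_eq B.mtopology_of_support)
  have "\<forall>\<^sub>F l in sequentially. case c of (j, s, a, b) \<Rightarrow> s \<in> tuples {..<m} (arity L (symbol_at L j)) \<and>
           of_rat a < f' (symbol_at L j) (map ((!) (q l)) s) \<and>
           f' (symbol_at L j) (map ((!) (q l)) s) < of_rat b" if "c \<in> set cs" for c
  proof -
    obtain j s a b where c: "c = (j, s, a, b)" by (cases c)
    define B where "B = symbol_at L j"
    have B: "B \<in> symbols L" unfolding B_def by (rule symbol_at_in[OF A.language])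
    have s: "s \<in> tuples {..<m} (arity L B)"
      and ab: "of_rat a < f B (map ((!) ys) s)" "f B (map ((!) ys) s) < of_rat b"
      using cs that unfolding c B_def by blast+
    have len: "length s = arity L B" and lt: "\<And>i. i < arity L B \<Longrightarrow> s ! i < m"
      using s by (auto simp: tuples_def subset_iff)
    have "(\<lambda>l. interp M' B (map (\<lambda>i. e' (q l ! i)) s)) \<longlonglongrightarrow> interp M' B (map z s)"
    proof (rule B.interp_tendsto[OF B, of "map (rank Q) s"])
      show "list_all2 (\<lambda>x n. x \<in> B.D n) (map z s) (map (rank Q) s)"
        using z lt len by (simp add: list_all2_conv_all_nth)
      show "list_all2 (\<lambda>x n. x \<in> B.D n) (map (\<lambda>i. e' (q l ! i)) s) (map (rank Q) s)" for l
        using q(2) B.e_in_domain lt len by (simp add: list_all2_conv_all_nth)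
      show "(\<lambda>l. B.\<delta> (map (\<lambda>i. e' (q l ! i)) s ! i) (map z s ! i)) \<longlonglongrightarrow> 0" if "i < arity L B" for i
        using q(3)[OF lt[OF that]] that len by simp
    qed (use len in simp)
    moreover have "interp M' B (map (\<lambda>i. e' (q l ! i)) s) = f' B (map ((!) (q l)) s)" for l
      using B.interp_e[OF B, of "map ((!) (q l)) s"] len by (simp add: tuples_def comp_def)
    moreover have "interp M' B (map z s) = f B (map ((!) ys) s)"
      using int[OF B, of "map e (map ((!) ys) s)"] A.interp_e[OF B, of "map ((!) ys) s"] len A.e_in_S
      by (simp add: tuples_def comp_def z_def[abs_def] image_subset_iff)
    ultimately have lim: "(\<lambda>l. f' B (map ((!) (q l)) s)) \<longlonglongrightarrow> f B (map ((!) ys) s)"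
      by simp
    show ?thesis
      unfolding c prod.case B_def[symmetric]
      using s eventually_conj[OF order_tendstoD(1)[OF lim ab(1)] order_tendstoD(2)[OF lim ab(2)]]
      by simp
  qed
  then have "\<forall>\<^sub>F l in sequentially. \<forall>c\<in>set cs. case c of (j, s, a, b) \<Rightarrow>
      s \<in> tuples {..<m} (arity L (symbol_at L j)) \<and>
           of_rat a < f' (symbol_at L j) (map ((!) (q l)) s) \<and>
           f' (symbol_at L j) (map ((!) (q l)) s) < of_rat b"
    by (intro eventually_ball_finite) auto
  then obtain l where "\<forall>c\<in>set cs. case c of (j, s, a, b) \<Rightarrow>
      s \<in> tuples {..<m} (arity L (symbol_at L j)) \<and>
           of_rat a < f' (symbol_at L j) (map ((!) (q l)) s) \<and>
           f' (symbol_at L j) (map ((!) (q l)) s) < of_rat b"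
    using eventually_happens'[OF sequentially_bot] by blast
  then show ?thesis
    unfolding realized_def using q(1,2) by blast
qed

text \<open>For each \<open>k\<close>, the values of the first \<open>k\<close> symbols on the first
  \<open>k\<close> codes of \<open>M\<close>, up to an error tending to 0, are reproduced by codes
  of \<open>M'\<close>. Compactness of the domains gives a limit sequence \<open>y\<close> that
  reproduces all values exactly, and \<open>embeddingI\<close> applies.\<close>

lemma realized_embedding:
  assumes real: "\<And>m cs. realized L Q f m cs \<Longrightarrow> realized L Q f' m cs"
    and proper: "\<And>n. compactin B.mtopology (B.D n)"
  shows "\<exists>\<phi>. embedding \<phi>"
proof -
  have "\<exists>ys. length ys = k \<and> (\<forall>i<k. ys ! i \<in> Q (rank Q i)) \<and>
      (\<forall>j<k. \<forall>s\<in>tuples {..<k} (arity L (symbol_at L j)).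
         \<bar>f' (symbol_at L j) (map ((!) ys) s) - f (symbol_at L j) s\<bar> < 2 * inverse (real (Suc k)))" for k
  proof -
    define \<epsilon> where "\<epsilon> = inverse (real (Suc k))"
    have "\<epsilon> > 0" by (simp add: \<epsilon>_def)
    then have "\<exists>a b. r - \<epsilon> < of_rat a \<and> of_rat a < r \<and> r < of_rat b \<and> of_rat b < r + \<epsilon>" for r :: real
      using of_rat_dense[of "r - \<epsilon>" r] of_rat_dense[of r "r + \<epsilon>"] by auto
    then obtain a b where ab: "\<And>r::real. r - \<epsilon> < of_rat (a r) \<and> of_rat (a r) < r \<and> r < of_rat (b r) \<and> of_rat (b r) < r + \<epsilon>"
      by metis
    \<comment> \<open>\<open>C\<close> is a finite list of rational boxes around the true values of
      \<open>f\<close>; the codes \<open>[0..<k]\<close> themselves realize it in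
      \<open>M\<close>.\<close>
    define C where "C = (\<Union>j<k. (\<lambda>s. (j, s, a (f (symbol_at L j) s), b (f (symbol_at L j) s))) `
        tuples {..<k} (arity L (symbol_at L j)))"
    have "finite (tuples {..<k} l)" for l
      unfolding tuples_def by (rule finite_lists_length_eq) simp
    then have "finite C" unfolding C_def by blast
    then obtain cs where cs: "set cs = C" using finite_list by blast
    have id: "map ((!) [0..<k]) s = s" if "s \<in> tuples {..<k} l" for s l
      using that by (auto simp: tuples_def subset_iff intro!: map_idI)
    have "realized L Q f k cs"
      unfolding realized_def
      by (rule exI[of _ "[0..<k]"])
         (use ab in \<open>auto simp: cs C_def id in_rank[OF A.filtration]\<close>)
    then have "realized L Q f' k cs" by (rule real)
    then obtain ys where ys: "length ys = k" "\<forall>i<k. ys ! i \<in> Q (rank Q i)"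
      and c: "\<forall>(j, s, a, b)\<in>C. of_rat a < f' (symbol_at L j) (map ((!) ys) s) \<and>
           f' (symbol_at L j) (map ((!) ys) s) < of_rat b"
      unfolding realized_def cs by blast
    have "\<bar>f' (symbol_at L j) (map ((!) ys) s) - f (symbol_at L j) s\<bar> < 2 * \<epsilon>"
      if "j < k" "s \<in> tuples {..<k} (arity L (symbol_at L j))" for j s
    proof -
      have "(j, s, a (f (symbol_at L j) s), b (f (symbol_at L j) s)) \<in> C"
        using that by (auto simp: C_def)
      then have "of_rat (a (f (symbol_at L j) s)) < f' (symbol_at L j) (map ((!) ys) s)"
        "f' (symbol_at L j) (map ((!) ys) s) < of_rat (b (f (symbol_at L j) s))"
        using c by blast+
      then show ?thesis using ab[of "f (symbol_at L j) s"] by linarith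
    qed
    with ys show ?thesis unfolding \<epsilon>_def by blast
  qed
  then obtain p where p: "\<And>k. length (p k) = k" "\<And>k i. i < k \<Longrightarrow> p k ! i \<in> Q (rank Q i)"
    "\<And>k j s. j < k \<Longrightarrow> s \<in> tuples {..<k} (arity L (symbol_at L j)) \<Longrightarrow>
       \<bar>f' (symbol_at L j) (map ((!) (p k)) s) - f (symbol_at L j) s\<bar> < 2 * inverse (real (Suc k))"
    by metis
  \<comment> \<open>The default \<open>i\<close> lies in \<open>Q (rank Q i)\<close>, so each
    \<open>u k\<close> is a full sequence in the prescribed domains. For fixed \<open>i\<close> it
    is used for finitely many \<open>k\<close> only and does not affect the limit.\<close>
  define u where "u k i = (if i < k then p k ! i else i)" for k i
  have u: "u k i \<in> Q (rank Q i)" for k i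
    using p(2) in_rank[OF A.filtration] by (simp add: u_def)
  obtain r y where r: "strict_mono r" and y: "\<And>i. y i \<in> B.D (rank Q i)"
    and lim: "\<And>i. (\<lambda>k. B.\<delta> (e' (u (r k) i)) (y i)) \<longlonglongrightarrow> 0"
    using B.compactin_diagonal_subsequence[of "\<lambda>i. B.D (rank Q i)" "\<lambda>k i. e' (u k i)"]
      proper B.e_in_domain[OF u] by blast
  have "interp M' B (map y s) = f B s" if B: "B \<in> symbols L" and s: "s \<in> tuples UNIV (arity L B)" for B s
  proof -
    have len: "length s = arity L B" using s by (simp add: tuples_def)
    obtain j where j: "B = symbol_at L j" using symbol_at_surj[OF A.language B] by blast
    have "(\<lambda>k. interp M' B (map (\<lambda>i. e' (u (r k) i)) s)) \<longlonglongrightarrow> interp M' B (map y s)"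
      by (rule B.interp_tendsto[OF B, of "map (rank Q) s"])
         (use len y lim B.e_in_domain[OF u] in \<open>auto simp: list_all2_conv_all_nth\<close>)
    moreover have "interp M' B (map (\<lambda>i. e' (u k i)) s) = f' B (map (u k) s)" for k
      using B.interp_e[OF B, of "map (u k) s"] len by (simp add: tuples_def comp_def)
    ultimately have 1: "(\<lambda>k. f' B (map (u (r k)) s)) \<longlonglongrightarrow> interp M' B (map y s)"
      by simp
    \<comment> \<open>From stage \<open>N\<close> on, both the symbol and all indices in
      \<open>s\<close> are among those controlled by \<open>p k\<close>.\<close>
    obtain N where N: "j < N" "set s \<subseteq> {..<N}"
    proof -
      obtain N0 where "set s \<subseteq> {..<N0}" using finite_nat_bounded[of "set s"] by auto
      then show thesis by (intro that[of "max N0 (Suc j)"]) auto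
    qed
    have "\<forall>\<^sub>F k in sequentially. norm (f' B (map (u k) s) - f B s) \<le> 2 * inverse (real (Suc k))"
      using eventually_ge_at_top[of N]
    proof eventually_elim
      case (elim k)
      have sk: "s \<in> tuples {..<k} (arity L B)" using N elim len by (auto simp: tuples_def)
      have "map (u k) s = map ((!) (p k)) s"
        using sk by (auto simp: tuples_def u_def)
      moreover have "\<bar>f' B (map ((!) (p k)) s) - f B s\<bar> < 2 * inverse (real (Suc k))"
        unfolding j by (rule p(3)) (use sk N elim in \<open>simp_all add: j\<close>)
      ultimately show ?case by (simp only: real_norm_def less_imp_le)
    qed
    then have "(\<lambda>k. f' B (map (u k) s) - f B s) \<longlonglongrightarrow> 0"
      by (rule Lim_null_comparison) (use tendsto_mult_left[OF LIMSEQ_inverse_real_of_nat, of 2] in simp)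
    then have "(\<lambda>k. f' B (map (u k) s)) \<longlonglongrightarrow> f B s"
      by (rule LIM_zero_cancel)
    then have "(\<lambda>k. f' B (map (u (r k)) s)) \<longlonglongrightarrow> f B s"
      using LIMSEQ_subseq_LIMSEQ[OF _ r] by (fastforce simp: comp_def)
    with 1 show ?thesis by (rule LIMSEQ_unique)
  qed
  with y show ?thesis by (rule embeddingI)
qed

end

text \<open>An isomorphism and its inverse transfer realized tests in both directions. Conversely,
  equal invariants yield embeddings both ways between the proper structures provided by
  \<open>Mod_p\<close>, hence an isomorphism.\<close>

lemma isomorphism_relation_iff_invariant:
  fixes L :: "'s language"
  assumes L: "countable_language L" and Q: "admissible_filtration Q"
    and f: "f \<in> Mod_p L Q" and f': "f' \<in> Mod_p L Q"
  shows "(f, f') \<in> isomorphism_relation L Q \<longleftrightarrow> invariant L Q f = invariant L Q f'"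
proof
  assume "(f, f') \<in> isomorphism_relation L Q"
  then obtain M M' :: "(nat \<Rightarrow> real, 's) mstructure" where
    "coded_by L Q f M" "coded_by L Q f' M'" and iso: "isomorphic_structures L M M'"
    unfolding isomorphism_relation_def by blast
  then obtain e e' where "presented L Q f M e" "presented L Q f' M' e'"
    using coded_by_iff_presented[OF L Q] by blast
  then interpret A: two_presented L Q f f' M e M' e'
    by (simp add: two_presented_def)
  interpret B: two_presented L Q f' f M' e' M e ..
  have "isomorphic_structures L M' M"
    by (rule isomorphic_structures_sym[OF iso A.A.domain_subset])
  then show "invariant L Q f = invariant L Q f'"
    unfolding invariant_eq_iff using A.isomorphic_realized[OF iso] B.isomorphic_realized by blast
next
  assume eq: "invariant L Q f = invariant L Q f'"
  obtain M M' :: "(nat \<Rightarrow> real, 's) mstructure" where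
    M: "coded_by L Q f M" "proper_structure L M" and M': "coded_by L Q f' M'" "proper_structure L M'"
    using f f' unfolding Mod_p_def by blast
  then obtain e e' where "presented L Q f M e" "presented L Q f' M' e'"
    using coded_by_iff_presented[OF L Q] by blast
  then interpret A: two_presented L Q f f' M e M' e'
    by (simp add: two_presented_def)
  interpret B: two_presented L Q f' f M' e' M e ..
  have pM: "compactin A.A.mtopology (A.A.D n)" and pM': "compactin A.B.mtopology (A.B.D n)" for n
    using M(2) M'(2) by (auto simp: proper_structure_def A.A.mtopology_of_support A.B.mtopology_of_support)
  obtain \<phi> where "A.embedding \<phi>"
    using A.realized_embedding[OF _ pM'] eq unfolding invariant_eq_iff by blast
  moreover obtain \<psi> where "B.embedding \<psi>"
    using B.realized_embedding[OF _ pM] eq unfolding invariant_eq_iff by blast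
  ultimately have "isomorphic_structures L M M'"
    using A.mutual_embeddings_isomorphic pM' by blast
  then show "(f, f') \<in> isomorphism_relation L Q"
    using M M' f f' unfolding isomorphism_relation_def by blast
qed

section \<open>Completions and total boundedness\<close>

lemma list_all2_bounded:
  assumes "list_all2 (\<lambda>x n::nat. x \<in> D n) xs ns" "\<And>m n. m \<le> n \<Longrightarrow> D m \<subseteq> D n"
  shows "\<exists>n. set xs \<subseteq> D n"
  using assms(1)
proof (induction rule: list_all2_induct)
  case (Cons x xs k ns)
  then obtain n where "set xs \<subseteq> D n" by blast
  then have "set (x # xs) \<subseteq> D (max n k)"
    using Cons(1) assms(2)[of n "max n k"] assms(2)[of k "max n k"] by auto
  then show ?case by blast
qed simp

text \<open>On tuples from the domains, relations are defined as limits of \<open>f B\<close> along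
  approximating codes; the moduli make these limits exist, independent of the approximation, and the
  moduli pass to them. Elsewhere the convention of \<open>coded_by\<close> is adopted.\<close>

lemma codes_completion:
  fixes L :: "'s language"
  assumes L: "countable_language L" and Q: "admissible_filtration Q" and f: "f \<in> codes L Q"
  shows "\<exists>(M :: (nat \<Rightarrow> real, 's) mstructure) e. presented L Q f M e"
proof -
  have mod: "respects_moduli L Q (code_dist L f) f" and met: "Metric_space UNIV (code_dist L f)"
    using f by (auto simp: codes_def)
  interpret N: Metric_space UNIV "code_dist L f" by (rule met)
  obtain e :: "nat \<Rightarrow> nat \<Rightarrow> real" and m' where
    complete: "mcomplete_of m'" and e_in: "\<And>i. e i \<in> mspace m'"
    and dense: "mtopology_of m' closure_of range e = mspace m'"
    and dist_e: "\<And>i j. mdist m' (e i) (e j) = code_dist L f i j"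
    by (rule N.metric_completion) (use that in auto)
  define S where "S = mspace m'"
  define \<delta> where "\<delta> = mdist m'"
  interpret Metric_space S \<delta> unfolding S_def \<delta>_def by (rule Metric_space_mspace_mdist)
  have mtop: "mtopology_of m' = mtopology" by (simp add: mtopology_of_def S_def \<delta>_def)
  have e_S: "e i \<in> S" "range e \<subseteq> S" for i using e_in by (auto simp: S_def)
  have e\<delta>: "\<delta> (e i) (e j) = code_dist L f i j" for i j by (simp add: \<delta>_def dist_e)
  define D where "D n = mtopology closure_of (e ` Q n)" for n
  have D_mono: "D m \<subseteq> D n" if "m \<le> n" for m n
    unfolding D_def by (intro closure_of_mono image_mono admissible_mono Q that)
  have D_S: "D n \<subseteq> S" for n
    unfolding D_def using closure_of_subset_topspace[of mtopology] by simp
  have e_D: "e i \<in> D n" if "i \<in> Q n" for i n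
    unfolding D_def by (rule subsetD[OF closure_of_subset]) (use e_S that in auto)
  \<comment> \<open>Approximating \<open>x\<close> by codes from its least domain gives a sequence
    valid in every domain containing \<open>x\<close>; hence the tuple sequence
    \<open>\<alpha> xs\<close> does not depend on the list of domains.\<close>
  define \<rho> where "\<rho> x = (LEAST n. x \<in> D n)" for x
  have \<rho>: "x \<in> D (\<rho> x)" "\<rho> x \<le> n" if "x \<in> D n" for x n
    using that unfolding \<rho>_def by (rule LeastI, rule Least_le)
  have "\<exists>u. x \<in> D (\<rho> x) \<longrightarrow> (\<forall>j. u j \<in> Q (\<rho> x)) \<and> (\<lambda>j. \<delta> (e (u j)) x) \<longlonglongrightarrow> 0" for x
  proof (cases "x \<in> D (\<rho> x)")
    case True
    then show ?thesis
      using closure_of_dense_sequence[OF True[unfolded D_def] e_S(2)] by blast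
  qed simp
  then obtain a where a: "\<And>x. x \<in> D (\<rho> x) \<longrightarrow> (\<forall>j. a x j \<in> Q (\<rho> x)) \<and> (\<lambda>j. \<delta> (e (a x j)) x) \<longlonglongrightarrow> 0"
    using choice[of "\<lambda>x u. x \<in> D (\<rho> x) \<longrightarrow> (\<forall>j. u j \<in> Q (\<rho> x)) \<and> (\<lambda>j. \<delta> (e (u j)) x) \<longlonglongrightarrow> 0"]
    by blast
  define \<alpha> where "\<alpha> xs j = map (\<lambda>x. a x j) xs" for xs and j :: nat
  define approx where "approx xs ns q \<longleftrightarrow>
    (\<forall>j. list_all2 (\<lambda>m n. m \<in> Q n) (q j) ns) \<and> (\<forall>i<length ns. (\<lambda>j. \<delta> (e (q j ! i)) (xs ! i)) \<longlonglongrightarrow> 0)"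
    for xs ns and q :: "nat \<Rightarrow> nat list"
  have approx_\<alpha>: "approx xs ns (\<alpha> xs)" if xs: "list_all2 (\<lambda>x n. x \<in> D n) xs ns" for xs ns
  proof -
    have len: "length xs = length ns" using xs by (rule list_all2_lengthD)
    have D: "xs ! i \<in> D (ns ! i)" if "i < length ns" for i
      using xs that by (simp add: list_all2_conv_all_nth)
    have "a (xs ! i) j \<in> Q (ns ! i)" if i: "i < length ns" for i j
      using a[of "xs ! i"] \<rho>[OF D[OF i]] admissible_mono[OF Q \<rho>(2)[OF D[OF i]]] by blast
    moreover have "(\<lambda>j. \<delta> (e (a (xs ! i) j)) (xs ! i)) \<longlonglongrightarrow> 0" if i: "i < length ns" for i
      using a[of "xs ! i"] \<rho>(1)[OF D[OF i]] by blast
    ultimately show ?thesis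
      by (simp add: approx_def \<alpha>_def len list_all2_conv_all_nth)
  qed
  \<comment> \<open>\<open>close\<close> compares approximations of two nearby tuples and gives the
    moduli. \<open>cauchy\<close> below compares two approximations of one tuple and gives existence
    and uniqueness of limits.\<close>
  have close: "\<forall>\<^sub>F j in sequentially. \<bar>f B (p j) - f B (q j)\<bar> \<le> \<epsilon>"
    if B: "B \<in> symbols L" and ns: "length ns = arity L B" and "\<epsilon> > 0"
      and xs: "list_all2 (\<lambda>x n. x \<in> D n) xs ns" and ys: "list_all2 (\<lambda>x n. x \<in> D n) ys ns"
      and p: "approx xs ns p" and q: "approx ys ns q"
      and lt: "\<And>i. i < arity L B \<Longrightarrow> \<delta> (xs ! i) (ys ! i) < modulus L B ns \<epsilon>"
    for B ns \<epsilon> xs ys p q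
  proof -
    have "(\<lambda>j. \<delta> (e (p j ! i)) (e (q j ! i))) \<longlonglongrightarrow> \<delta> (xs ! i) (ys ! i)" if "i < arity L B" for i
      by (rule dist_tendsto)
         (use that xs ys p q ns D_S e_S in \<open>auto simp: approx_def list_all2_conv_all_nth subset_iff\<close>)
    then have "\<forall>\<^sub>F j in sequentially. \<forall>i\<in>{..<arity L B}. \<delta> (e (p j ! i)) (e (q j ! i)) < modulus L B ns \<epsilon>"
      using lt by (intro eventually_ball_finite ballI order_tendstoD(2)) auto
    then show ?thesis
    proof eventually_elim
      case (elim j)
      show ?case
        by (rule respects_moduliD[OF mod B ns \<open>\<epsilon> > 0\<close>])
           (use p q elim in \<open>auto simp: approx_def e\<delta>\<close>)
    qed
  qed
  have cauchy: "\<exists>N. \<forall>j\<ge>N. \<forall>j'\<ge>N. \<bar>f B (p j) - f B (q j')\<bar> \<le> \<epsilon>"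
    if B: "B \<in> symbols L" and ns: "length ns = arity L B" and "\<epsilon> > 0"
      and xs: "list_all2 (\<lambda>x n. x \<in> D n) xs ns"
      and p: "approx xs ns p" and q: "approx xs ns q"
    for B ns \<epsilon> xs p q
  proof -
    define \<eta> where "\<eta> = modulus L B ns \<epsilon>"
    have \<eta>: "\<eta>/2 > 0" unfolding \<eta>_def using modulus_pos[OF L B ns \<open>\<epsilon> > 0\<close>] by simp
    have "\<forall>\<^sub>F j in sequentially. \<forall>i\<in>{..<arity L B}. \<delta> (e (p j ! i)) (xs ! i) < \<eta>/2 \<and> \<delta> (e (q j ! i)) (xs ! i) < \<eta>/2"
      using p q ns order_tendstoD(2)[OF _ \<eta>]
      by (intro eventually_ball_finite ballI eventually_conj) (auto simp: approx_def)
    then obtain N where N: "\<And>j i. j \<ge> N \<Longrightarrow> i < arity L B \<Longrightarrow> \<delta> (e (p j ! i)) (xs ! i) < \<eta>/2 \<and> \<delta> (e (q j ! i)) (xs ! i) < \<eta>/2"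
      unfolding eventually_sequentially by auto
    have "\<bar>f B (p j) - f B (q j')\<bar> \<le> \<epsilon>" if jj: "j \<ge> N" "j' \<ge> N" for j j'
    proof (rule respects_moduliD[OF mod B ns \<open>\<epsilon> > 0\<close>])
      fix i assume i: "i < arity L B"
      have "xs ! i \<in> D (ns ! i)" using xs i ns by (simp add: list_all2_conv_all_nth)
      then have "xs ! i \<in> S" using D_S by blast
      from triangle[OF e_S(1) this e_S(1), of "p j ! i" "q j' ! i"]
      have "\<delta> (e (p j ! i)) (e (q j' ! i)) < \<eta>"
        using N[OF jj(1) i] N[OF jj(2) i] commute[of "xs ! i" "e (q j' ! i)"] by linarith
      then show "code_dist L f (p j ! i) (q j' ! i) < modulus L B ns \<epsilon>" by (simp add: e\<delta> \<eta>_def)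
    qed (use p q in \<open>auto simp: approx_def\<close>)
    then show ?thesis by blast
  qed
  define val where "val B xs = lim (\<lambda>j. f B (\<alpha> xs j))" for B xs
  have val: "(\<lambda>j. f B (q j)) \<longlonglongrightarrow> val B xs"
    if B: "B \<in> symbols L" and ns: "length ns = arity L B" 
      and xs: "list_all2 (\<lambda>x n. x \<in> D n) xs ns" and q: "approx xs ns q" for B ns xs q
  proof -
    have "Cauchy (\<lambda>j. f B (\<alpha> xs j))"
    proof (rule CauchyI)
      fix \<epsilon> :: real assume "\<epsilon> > 0"
      then have "\<epsilon>/2 > 0" by simp
      then obtain N where N: "\<And>j j'. j \<ge> N \<Longrightarrow> j' \<ge> N \<Longrightarrow> \<bar>f B (\<alpha> xs j) - f B (\<alpha> xs j')\<bar> \<le> \<epsilon>/2"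
        using cauchy[OF B ns _ xs approx_\<alpha>[OF xs] approx_\<alpha>[OF xs]] by meson
      have "norm (f B (\<alpha> xs j) - f B (\<alpha> xs j')) < \<epsilon>" if "j \<ge> N" "j' \<ge> N" for j j'
        using N[OF that] \<open>\<epsilon> > 0\<close> by simp
      then show "\<exists>N. \<forall>m\<ge>N. \<forall>n\<ge>N. norm (f B (\<alpha> xs m) - f B (\<alpha> xs n)) < \<epsilon>" by blast
    qed
    then have lim\<alpha>: "(\<lambda>j. f B (\<alpha> xs j)) \<longlonglongrightarrow> val B xs"
      unfolding val_def by (simp add: Cauchy_convergent convergent_LIMSEQ_iff[symmetric])
    have "(\<lambda>j. f B (\<alpha> xs j) - f B (q j)) \<longlonglongrightarrow> 0"
    proof (rule LIMSEQ_I)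
      fix \<epsilon> :: real assume "\<epsilon> > 0"
      then have "\<epsilon>/2 > 0" by simp
      then obtain N where N: "\<And>j j'. j \<ge> N \<Longrightarrow> j' \<ge> N \<Longrightarrow> \<bar>f B (\<alpha> xs j) - f B (q j')\<bar> \<le> \<epsilon>/2"
        using cauchy[OF B ns _ xs approx_\<alpha>[OF xs] q] by meson
      have "norm (f B (\<alpha> xs j) - f B (q j) - 0) < \<epsilon>" if "j \<ge> N" for j
        using N[OF that that] \<open>\<epsilon> > 0\<close> by simp
      then show "\<exists>N. \<forall>j\<ge>N. norm (f B (\<alpha> xs j) - f B (q j) - 0) < \<epsilon>" by blast
    qed
    from tendsto_diff[OF lim\<alpha> this] show ?thesis by simp
  qed
  define R where "R B xs = (if \<exists>n. set xs \<subseteq> D n then val B xs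
      else if \<exists>r. dense_limit L f m' e B xs r then SOME r. dense_limit L f m' e B xs r else 0)" for B xs
  have R_val: "R B xs = val B xs" if "list_all2 (\<lambda>x n. x \<in> D n) xs ns" for B xs ns
    using list_all2_bounded[OF that D_mono] by (simp add: R_def)
  define M where "M = \<lparr>support = m', domain = D, interp = R\<rparr>"
  \<comment> \<open>The strict bound on distances passes to the approximating codes eventually, and
    the non-strict bound on values passes back to the limit.\<close>
  have R_mod: "respects_moduli L D \<delta> R"
    unfolding respects_moduli_def
  proof (intro ballI allI impI, elim conjE)
    fix B ns and \<epsilon> :: real and xs ys
    assume B: "B \<in> symbols L" and ns: "length ns = arity L B" and "\<epsilon> > 0"
      and xs: "list_all2 (\<lambda>x n. x \<in> D n) xs ns" and ys: "list_all2 (\<lambda>x n. x \<in> D n) ys ns"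
      and lt: "\<forall>i<arity L B. \<delta> (xs ! i) (ys ! i) < modulus L B ns \<epsilon>"
    have "\<bar>val B xs - val B ys\<bar> \<le> \<epsilon>"
    proof (rule tendsto_upperbound)
      show "(\<lambda>j. \<bar>f B (\<alpha> xs j) - f B (\<alpha> ys j)\<bar>) \<longlonglongrightarrow> \<bar>val B xs - val B ys\<bar>"
        by (intro tendsto_rabs tendsto_diff val[OF B ns xs] val[OF B ns ys] approx_\<alpha> xs ys)
      show "\<forall>\<^sub>F j in sequentially. \<bar>f B (\<alpha> xs j) - f B (\<alpha> ys j)\<bar> \<le> \<epsilon>"
        by (rule close[OF B ns \<open>\<epsilon> > 0\<close> xs ys]) (use approx_\<alpha> xs ys lt in auto)
    qed simp
    then show "\<bar>R B xs - R B ys\<bar> \<le> \<epsilon>"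
      using R_val xs ys by simp
  qed
  have R_e: "R B (map e ms) = f B ms" if B: "B \<in> symbols L" and ms: "ms \<in> tuples UNIV (arity L B)" for B ms
  proof -
    let ?ns = "map (rank Q) ms"
    have D: "list_all2 (\<lambda>x n. x \<in> D n) (map e ms) ?ns"
      using e_D[OF in_rank[OF Q]] by (simp add: list_all2_conv_all_nth)
    moreover have "approx (map e ms) ?ns (\<lambda>_. ms)"
      using in_rank[OF Q] e_S by (simp add: approx_def list_all2_conv_all_nth)
    ultimately have "(\<lambda>j. f B ms) \<longlonglongrightarrow> val B (map e ms)"
      using val[OF B, of ?ns "map e ms" "\<lambda>_. ms"] ms by (simp add: tuples_def)
    then have "val B (map e ms) = f B ms"
      by (simp add: LIMSEQ_const_iff)
    then show ?thesis using R_val[OF D] by simp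
  qed
  have dist: "dist_symbol L \<in> symbols L" "arity L (dist_symbol L) = 2"
    using L by (auto simp: countable_language_def)
  \<comment> \<open>The equality is required on the whole support. For a pair in no common domain,
    the distance is a dense limit by continuity of the metric, and by uniqueness it is the value
    selected in \<open>R\<close>.\<close>
  have R_dist: "R (dist_symbol L) [x, y] = \<delta> x y" if xy: "x \<in> S" "y \<in> S" for x y
  proof -
    have conv: "(\<lambda>j. f (dist_symbol L) (q j)) \<longlonglongrightarrow> \<delta> x y"
      if len: "\<And>j. length (q j) = 2" and lim: "\<And>i. i < 2 \<Longrightarrow> (\<lambda>j. \<delta> (e (q j ! i)) ([x, y] ! i)) \<longlonglongrightarrow> 0" for q
    proof -
      have "q j = [q j ! 0, q j ! 1]" for j
        using len[of j] by (auto simp: length_Suc_conv numeral_2_eq_2)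
      then have "f (dist_symbol L) (q j) = \<delta> (e (q j ! 0)) (e (q j ! 1))" for j
        by (metis code_dist_def e\<delta>)
      moreover have "(\<lambda>j. \<delta> (e (q j ! 0)) (e (q j ! 1))) \<longlonglongrightarrow> \<delta> x y"
        by (rule dist_tendsto) (use e_S xy lim[of 0] lim[of 1] in auto)
      ultimately show ?thesis by simp
    qed
    show ?thesis
    proof (cases "\<exists>n. set [x, y] \<subseteq> D n")
      case True
      then obtain n where n: "list_all2 (\<lambda>x n. x \<in> D n) [x, y] [n, n]" by auto
      have "(\<lambda>j. f (dist_symbol L) (\<alpha> [x, y] j)) \<longlonglongrightarrow> \<delta> x y"
        by (rule conv) (use approx_\<alpha>[OF n] in \<open>auto simp: approx_def \<alpha>_def\<close>)
      moreover have "(\<lambda>j. f (dist_symbol L) (\<alpha> [x, y] j)) \<longlonglongrightarrow> val (dist_symbol L) [x, y]"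
        by (rule val[OF dist(1) _ n approx_\<alpha>[OF n]]) (simp add: dist)
      ultimately show ?thesis using R_val[OF n] LIMSEQ_unique by metis
    next
      case False
      have dl: "dense_limit L f m' e (dist_symbol L) [x, y] (\<delta> x y)"
        unfolding dense_limit_def dist \<delta>_def[symmetric]
        using conv by (auto simp: tuples_def)
      then have "dense_limit L f m' e (dist_symbol L) [x, y] (SOME r. dense_limit L f m' e (dist_symbol L) [x, y] r)"
        by (rule someI)
      then have "(SOME r. dense_limit L f m' e (dist_symbol L) [x, y] r) = \<delta> x y"
        using dense_limit_unique[OF e_S(2)[unfolded S_def] dense _ _ dl] xy dist
        by (auto simp: tuples_def S_def)
      then show ?thesis using False dl unfolding R_def by auto
    qed
  qed
  have "separable_space mtopology"
    unfolding separable_space_def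
    by (intro exI[of _ "range e"]) (use e_S dense in \<open>simp_all add: mtop S_def[symmetric]\<close>)
  then have "is_structure L M"
    unfolding is_structure_def M_def
    using e_S(1) complete R_mod R_dist
    by (auto simp: mtop D_def S_def[symmetric] \<delta>_def[symmetric])
  moreover have "if \<exists>r. dense_limit L f m' e B xs r then dense_limit L f m' e B xs (R B xs) else R B xs = 0"
    if "\<nexists>n. set xs \<subseteq> D n" for B xs
    using that someI_ex[of "dense_limit L f m' e B xs"] by (auto simp: R_def)
  ultimately have "presented L Q f M e"
    unfolding presented_def using L Q R_e e_S e\<delta> dense
    by (auto simp: M_def mtop D_def S_def[symmetric] \<delta>_def[symmetric])
  then show ?thesis by blast
qed

section \<open>Properness as total boundedness of the coding sets\<close>

text \<open>The number \<open>c\<close> encodes the finite list of centres. The non-strict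
  inequality makes this a closed condition on the code.\<close>

definition finite_net ::
  "'s language \<Rightarrow> (nat \<Rightarrow> nat set) \<Rightarrow> ('s \<Rightarrow> nat list \<Rightarrow> real) \<Rightarrow> nat \<Rightarrow> nat \<Rightarrow> nat \<Rightarrow> bool" where
  "finite_net L Q f n k c \<longleftrightarrow> set (from_nat c) \<subseteq> Q n \<and>
     (\<forall>x\<in>Q n. \<exists>y\<in>set (from_nat c). code_dist L f y x \<le> inverse (real (Suc k)))"

text \<open>In a complete space the closure of a set is compact exactly when the set is totally
  bounded, which can be tested on codes at the radii \<open>1/(k+1)\<close>. The structure required
  for the converse comes from \<open>codes_completion\<close>.\<close>

lemma Mod_p_iff:
  fixes L :: "'s language"
  assumes L: "countable_language L" and Q: "admissible_filtration Q"
  shows "f \<in> Mod_p L Q \<longleftrightarrow> f \<in> codes L Q \<and> (\<forall>n k. \<exists>c. finite_net L Q f n k c)"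
proof (intro iffI conjI allI)
  assume "f \<in> Mod_p L Q"
  then obtain M :: "(nat \<Rightarrow> real, 's) mstructure" where M: "coded_by L Q f M" "proper_structure L M"
    and "f \<in> codes L Q"
    unfolding Mod_p_def by blast
  then show "f \<in> codes L Q" by simp
  obtain e where "presented L Q f M e"
    using M(1) coded_by_iff_presented[OF L Q] by blast
  then interpret presented L Q f M e .
  fix n k
  have "mtotally_bounded (e ` Q n)"
  proof (rule compact_closure_of_imp_mtotally_bounded)
    show "compactin mtopology (mtopology closure_of e ` Q n)"
      using M(2) unfolding proper_structure_def domain_eq mtopology_of_support by blast
  qed (use e_in_S in auto)
  then obtain K where K: "finite K" "K \<subseteq> e ` Q n" "e ` Q n \<subseteq> (\<Union>x\<in>K. mball x (inverse (real (Suc k))))"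
    unfolding mtotally_bounded_def by (meson inverse_positive_iff_positive of_nat_0_less_iff zero_less_Suc)
  then obtain K0 where K0: "K0 \<subseteq> Q n" "finite K0" "K = e ` K0"
    using finite_subset_image by metis
  then obtain ys where ys: "set ys = K0" using finite_list by blast
  have "\<exists>y\<in>K0. code_dist L f y x \<le> inverse (real (Suc k))" if "x \<in> Q n" for x
  proof -
    have "e x \<in> (\<Union>x\<in>K. mball x (inverse (real (Suc k))))" using K(3) that by blast
    then obtain y where "y \<in> K0" "\<delta> (e y) (e x) < inverse (real (Suc k))"
      unfolding K0(3) by (auto simp: in_mball)
    then show ?thesis using dist_e less_imp_le by metis
  qed
  then have "finite_net L Q f n k (to_nat ys)"
    using K0(1) by (simp add: finite_net_def ys)
  then show "\<exists>c. finite_net L Q f n k c" by blast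
next
  assume asm: "f \<in> codes L Q \<and> (\<forall>n k. \<exists>c. finite_net L Q f n k c)"
  then obtain M :: "(nat \<Rightarrow> real, 's) mstructure" and e where pres: "presented L Q f M e"
    using codes_completion[OF L Q] by blast
  then interpret presented L Q f M e .
  have "mtotally_bounded (e ` Q n)" for n
    unfolding mtotally_bounded_def
  proof (intro allI impI)
    fix \<epsilon> :: real assume "\<epsilon> > 0"
    then obtain k where k: "inverse (real (Suc k)) < \<epsilon>" using reals_Archimedean by blast
    obtain c where "finite_net L Q f n k c" using asm by blast
    then have c: "set (from_nat c) \<subseteq> Q n"
      "\<forall>x\<in>Q n. \<exists>y\<in>set (from_nat c). code_dist L f y x \<le> inverse (real (Suc k))"
      unfolding finite_net_def by (rule conjunct1, rule conjunct2)
    have "e x \<in> (\<Union>z\<in>e ` set (from_nat c). mball z \<epsilon>)" if x: "x \<in> Q n" for x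
    proof -
      obtain y where "y \<in> set (from_nat c)" "code_dist L f y x \<le> inverse (real (Suc k))"
        using c(2) x by blast
      then have "y \<in> set (from_nat c)" "\<delta> (e y) (e x) < \<epsilon>"
        using k dist_e[of y x] by simp_all
      then show ?thesis using e_in_S by auto
    qed
    moreover have "e ` set (from_nat c) \<subseteq> e ` Q n"
      using c(1) by (rule image_mono)
    ultimately show "\<exists>K. finite K \<and> K \<subseteq> e ` Q n \<and> e ` Q n \<subseteq> (\<Union>x\<in>K. mball x \<epsilon>)"
      by (intro exI[of _ "e ` set (from_nat c)"]) auto
  qed
  moreover have mcomplete using complete by (simp add: mcomplete_of_def)
  ultimately have "compactin mtopology (D n)" for n
    unfolding domain_eq mtopology_of_support using mtotally_bounded_eq_compact_closure_of by blast
  then have "proper_structure L M"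
    by (simp add: proper_structure_def structure_M mtopology_of_support)
  moreover have "coded_by L Q f M" using pres coded_by_iff_presented[OF L Q] by blast
  ultimately show "f \<in> Mod_p L Q" using asm unfolding Mod_p_def by blast
qed

section \<open>The standard Borel space of proper codes\<close>

definition coordinates :: "'s language \<Rightarrow> ('s \<times> nat list) set" where
  "coordinates L = Sigma (symbols L) (\<lambda>B. tuples UNIV (arity L B))"

lemma coordinates_countable: "countable_language L \<Longrightarrow> countable (coordinates L)"
  unfolding coordinates_def countable_language_def by (intro countable_SIGMA) auto

text \<open>Infinitude makes \<open>from_nat_into\<close> injective on the natural numbers, so that
  distinct indices address distinct coordinates of a code.\<close>

lemma coordinates_infinite:
  assumes "countable_language L"
  shows "infinite (coordinates L)"
proof -
  have "inj (\<lambda>n::nat. (dist_symbol L, [n, n]))" by (auto intro: injI)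
  then have "infinite (range (\<lambda>n::nat. (dist_symbol L, [n, n])))"
    by (rule range_inj_infinite)
  moreover have "range (\<lambda>n::nat. (dist_symbol L, [n, n])) \<subseteq> coordinates L"
    using assms by (auto simp: coordinates_def countable_language_def tuples_def)
  ultimately show ?thesis using finite_subset by blast
qed

text \<open>
  A proper code is presented together with a function choosing least finite nets: this turns the
  existential quantifiers in the definition of total boundedness into a \<open>G\<^sub>\<delta>\<close> condition.
\<close>

definition encode ::
  "'s language \<Rightarrow> (nat \<Rightarrow> nat set) \<Rightarrow> ('s \<Rightarrow> nat list \<Rightarrow> real) \<Rightarrow> nat + nat \<times> nat \<Rightarrow> real" where
  "encode L Q f = case_sum (\<lambda>i. case from_nat_into (coordinates L) i of (B, ms) \<Rightarrow> f B ms)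
     (\<lambda>(n, k). real (LEAST c. finite_net L Q f n k c))"

text \<open>A left inverse of \<open>encode\<close> on the code space that drops the net
  coordinates. The restricted abstractions place every decoded point in the extensional
  product.\<close>

definition decode :: "'s language \<Rightarrow> (nat + nat \<times> nat \<Rightarrow> real) \<Rightarrow> 's \<Rightarrow> nat list \<Rightarrow> real" where
  "decode L z = (\<lambda>B\<in>symbols L. \<lambda>ms\<in>tuples UNIV (arity L B). z (Inl (to_nat_on (coordinates L) (B, ms))))"

lemma space_code_space:
  "space (code_space L) = (\<Pi>\<^sub>E B\<in>symbols L. \<Pi>\<^sub>E ms\<in>tuples UNIV (arity L B). UNIV)"
  by (simp add: code_space_def space_PiM)

lemma decode_in_space: "decode L z \<in> space (code_space L)"
  unfolding space_code_space decode_def by auto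

lemma decode_encode:
  assumes L: "countable_language L" and f: "f \<in> space (code_space L)"
  shows "decode L (encode L Q f) = f"
proof (intro ext)
  fix B ms
  show "decode L (encode L Q f) B ms = f B ms"
  proof (cases "(B, ms) \<in> coordinates L")
    case True
    then show ?thesis
      using from_nat_into_to_nat_on[OF coordinates_countable[OF L] True]
      by (simp add: decode_def encode_def coordinates_def)
  next
    case False
    consider "B \<notin> symbols L" | "B \<in> symbols L" "ms \<notin> tuples UNIV (arity L B)"
      using False by (auto simp: coordinates_def)
    then show ?thesis
    proof cases
      case 1
      then have "f B = undefined" using f by (auto simp: space_code_space PiE_def extensional_def)
      then show ?thesis using 1 by (simp add: decode_def)
    next
      case 2
      then have "f B \<in> extensional (tuples UNIV (arity L B))"
        using f by (auto simp: space_code_space PiE_def)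
      then show ?thesis using 2 by (simp add: decode_def extensional_def)
    qed
  qed
qed

lemma encode_decode_Inl:
  assumes L: "countable_language L"
  shows "encode L Q (decode L z) (Inl i) = z (Inl i)"
proof -
  obtain B ms where B: "from_nat_into (coordinates L) i = (B, ms)" by fastforce
  have "(B, ms) \<in> coordinates L"
    using from_nat_into[of "coordinates L" i] coordinates_infinite[OF L] B by fastforce
  then have "B \<in> symbols L" "ms \<in> tuples UNIV (arity L B)"
    by (auto simp: coordinates_def)
  moreover have "to_nat_on (coordinates L) (B, ms) = i"
    unfolding B[symmetric]
    by (rule to_nat_on_from_nat_into_infinite[OF coordinates_countable[OF L] coordinates_infinite[OF L]])
  ultimately show ?thesis
    by (simp add: encode_def decode_def B)
qed

text \<open>Once a net coordinate is known to be natural, quantifying universally over the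
  \<open>c\<close> equal to it expresses the same as an existential quantifier, but as a countable
  intersection.\<close>

lemma encode_image:
  fixes L :: "'s language"
  assumes L: "countable_language L" and Q: "admissible_filtration Q"
  shows "encode L Q ` Mod_p L Q =
    {z. decode L z \<in> codes L Q \<and> (\<forall>n k. z (Inr (n, k)) \<in> \<nat> \<and>
       (\<forall>c. z (Inr (n, k)) = real c \<longrightarrow>
          finite_net L Q (decode L z) n k c \<and> (\<forall>c'. c' < c \<longrightarrow> \<not> finite_net L Q (decode L z) n k c')))}"
    (is "_ = ?R")
proof (intro equalityI subsetI)
  fix z assume "z \<in> encode L Q ` Mod_p L Q"
  then obtain f where f: "f \<in> Mod_p L Q" and z: "z = encode L Q f" by blast
  have fc: "f \<in> codes L Q" and net: "\<And>n k. \<exists>c. finite_net L Q f n k c"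
    using f Mod_p_iff[OF L Q] by blast+
  have dec: "decode L z = f"
    unfolding z by (rule decode_encode[OF L]) (use fc in \<open>simp add: codes_def\<close>)
  define m where "m n k = (LEAST c. finite_net L Q f n k c)" for n k
  have zm: "z (Inr (n, k)) = real (m n k)" for n k
    by (simp add: z encode_def m_def)
  have m: "finite_net L Q f n k (m n k)" "c' < m n k \<Longrightarrow> \<not> finite_net L Q f n k c'" for n k c'
    unfolding m_def using LeastI_ex[OF net] not_less_Least by blast+
  show "z \<in> ?R"
    unfolding mem_Collect_eq dec zm of_nat_eq_iff using fc m of_nat_in_Nats by blast
next
  fix z assume z: "z \<in> ?R"
  note z_conj = z[unfolded mem_Collect_eq]
  have z_nat: "z (Inr (n, k)) \<in> \<nat>" for n k
    by (rule conjunct1[OF spec[OF spec[OF conjunct2[OF z_conj]]]])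
  have z_net: "finite_net L Q (decode L z) n k c" "c' < c \<Longrightarrow> \<not> finite_net L Q (decode L z) n k c'"
    if "z (Inr (n, k)) = real c" for n k c c'
    using conjunct2[OF spec[OF spec[OF conjunct2[OF z_conj]]]] that by blast+
  have ex: "\<exists>c. finite_net L Q (decode L z) n k c" for n k
    by (rule Nats_cases[OF z_nat[of n k]]) (use z_net(1) in blast)
  \<comment> \<open>Minimality forces the net coordinate to be the number computed by
    \<open>encode\<close>.\<close>
  have Inr: "encode L Q (decode L z) (Inr (n, k)) = z (Inr (n, k))" for n k
  proof -
    obtain c where c: "z (Inr (n, k)) = real c" using z_nat by (rule Nats_cases)
    have "(LEAST c. finite_net L Q (decode L z) n k c) = c"
      by (rule Least_equality) (use z_net[OF c] in \<open>auto intro: leI\<close>)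
    then show ?thesis by (simp add: encode_def c)
  qed
  have "encode L Q (decode L z) = z"
  proof
    show "encode L Q (decode L z) i = z i" for i
      using encode_decode_Inl[OF L] Inr by (cases i) auto
  qed
  moreover have "decode L z \<in> Mod_p L Q"
    unfolding Mod_p_iff[OF L Q] using conjunct1[OF z_conj] ex by blast
  ultimately show "z \<in> encode L Q ` Mod_p L Q" by (metis image_eqI)
qed

section \<open>G-delta complexity of the enlarged codes\<close>

lemma continuous_decode [continuous_intros]: "continuous_on UNIV (\<lambda>z. decode L z B ms)"
proof (cases "B \<in> symbols L \<and> ms \<in> tuples UNIV (arity L B)")
  case True
  then show ?thesis by (simp add: decode_def continuous_on_product_coordinates)
next
  case False
  then show ?thesis by (cases "B \<in> symbols L") (simp_all add: decode_def)
qed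

text \<open>Vanishing on the diagonal is closed and non-vanishing off it is open; the remaining
  axioms are closed, and there are countably many instances.\<close>

lemma gdelta_metric: "gdelta_in euclidean {z. Metric_space UNIV (code_dist L (decode L z))}"
proof -
  have "gdelta_in euclidean {z. code_dist L (decode L z) x y = 0 \<longleftrightarrow> x = y}" for x y
  proof (cases "x = y")
    case True
    then show ?thesis unfolding code_dist_def
      by simp (intro gdelta_closed closed_Collect_eq continuous_intros)
  next
    case False
    then show ?thesis unfolding code_dist_def
      by simp (intro gdelta_open open_Collect_neq continuous_intros)
  qed
  moreover have "gdelta_in euclidean {z. 0 \<le> code_dist L (decode L z) x y}"
    "gdelta_in euclidean {z. code_dist L (decode L z) x y = code_dist L (decode L z) y x}"
    "gdelta_in euclidean {z. code_dist L (decode L z) x w \<le> code_dist L (decode L z) x y + code_dist L (decode L z) y w}"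
    for x y w
    unfolding code_dist_def
    by (intro gdelta_closed closed_Collect_le closed_Collect_eq continuous_intros)+
  ultimately show ?thesis
    unfolding Metric_space_def by (simp only: UNIV_I simp_thms) (intro gdelta_conj gdelta_INT)
qed

text \<open>An open premise and a closed conclusion make each instance closed. Closedness, unlike
  being G-delta, survives the intersection over uncountably many \<open>\<epsilon>\<close>.\<close>

lemma closed_respects_moduli:
  "closed {z. respects_moduli L Q (code_dist L (decode L z)) (decode L z)}"
proof -
  have step: "closed {z. (\<forall>i<k. code_dist L (decode L z) (xs ! i) (ys ! i) < r) \<longrightarrow>
      \<bar>decode L z B xs - decode L z B ys\<bar> \<le> \<epsilon>}" for k xs ys r \<epsilon> B
  proof (rule closed_Collect_imp)
    have "open (\<Inter>i\<in>{..<k}. {z. code_dist L (decode L z) (xs ! i) (ys ! i) < r})"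
      unfolding code_dist_def by (intro open_INT ballI open_Collect_less continuous_intros) simp
    also have "(\<Inter>i\<in>{..<k}. {z. code_dist L (decode L z) (xs ! i) (ys ! i) < r})
        = {z. \<forall>i<k. code_dist L (decode L z) (xs ! i) (ys ! i) < r}" by auto
    finally show "open {z. \<forall>i<k. code_dist L (decode L z) (xs ! i) (ys ! i) < r}" .
  qed (intro closed_Collect_le continuous_intros)
  show ?thesis
    unfolding respects_moduli_def Ball_def imp_conjL
    by (rule closed_Collect_all closed_Collect_imp[OF open_Collect_const] step)+
qed

text \<open>The existential quantifier runs over the finitely many centres, so it is a finite union
  of closed sets.\<close>

lemma closed_finite_net: "closed {z. finite_net L Q (decode L z) n k c}"
proof -
  have "closed {z. \<exists>y\<in>set (from_nat c). code_dist L (decode L z) y x \<le> inverse (real (Suc k))}" for x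
  proof -
    have "closed (\<Union>y\<in>set (from_nat c). {z. code_dist L (decode L z) y x \<le> inverse (real (Suc k))})"
      unfolding code_dist_def by (intro closed_UN ballI closed_Collect_le continuous_intros) simp
    also have "(\<Union>y\<in>set (from_nat c). {z. code_dist L (decode L z) y x \<le> inverse (real (Suc k))})
      = {z. \<exists>y\<in>set (from_nat c). code_dist L (decode L z) y x \<le> inverse (real (Suc k))}" by auto
    finally show ?thesis .
  qed
  then show ?thesis
    unfolding finite_net_def Ball_def
    by (intro closed_Collect_conj closed_Collect_const closed_Collect_all closed_Collect_imp open_Collect_const)
qed

text \<open>Being a net is closed and failing to be one is open, so leastness of the recorded net is
  a countable intersection of G-delta conditions.\<close>

lemma gdelta_encode_image:
  fixes L :: "'s language"
  assumes L: "countable_language L" and Q: "admissible_filtration Q"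
  shows "gdelta_in euclidean (encode L Q ` Mod_p L Q)"
  unfolding encode_image[OF L Q] codes_def mem_Collect_eq
proof (intro gdelta_conj gdelta_INT gdelta_imp)
  show "gdelta_in euclidean {z. decode L z \<in> space (code_space L)}"
    by (simp add: decode_in_space gdelta_open)
  show "gdelta_in euclidean {z::nat + nat \<times> nat \<Rightarrow> real. z (Inr (n, k)) \<in> \<nat>}" for n k
  proof -
    have "closed ((\<lambda>z::nat + nat \<times> nat \<Rightarrow> real. z (Inr (n, k))) -` \<nat>)"
      by (intro closed_vimage closed_Nats continuous_on_product_coordinates)
    then show ?thesis by (simp add: gdelta_closed vimage_def)
  qed
  show "gdelta_in euclidean {z::nat + nat \<times> nat \<Rightarrow> real. z (Inr (n, k)) \<noteq> real c}" for n k c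
    by (intro gdelta_open open_Collect_neq continuous_on_product_coordinates continuous_on_const)
  show "gdelta_in euclidean {z. \<not> finite_net L Q (decode L z) n k c}" for n k c
    by (rule gdelta_open) (use closed_finite_net in \<open>simp add: closed_def Collect_neg_eq[symmetric]\<close>)
  show "gdelta_in euclidean {z. \<not> c' < c}" for c' c :: nat
    by (cases "c' < c") (simp_all add: gdelta_open)
qed (intro gdelta_metric gdelta_closed closed_respects_moduli closed_finite_net)+

section \<open>Borel measurability of the encoding and the invariant\<close>

text \<open>Outside the coordinates of the product, evaluation is constant on extensional functions,
  so no side condition on \<open>B\<close> and \<open>ms\<close> arises.\<close>

lemma measurable_value [measurable]: "(\<lambda>f. f B ms) \<in> borel_measurable (code_space L)"
proof (cases "B \<in> symbols L \<and> ms \<in> tuples UNIV (arity L B)")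
  case True
  then have "(\<lambda>f. f B) \<in> measurable (code_space L) (\<Pi>\<^sub>M ms\<in>tuples UNIV (arity L B). borel)"
    unfolding code_space_def by (intro measurable_component_singleton) simp
  moreover have "(\<lambda>g. g ms) \<in> borel_measurable (\<Pi>\<^sub>M ms\<in>tuples UNIV (arity L B). (borel :: real measure))"
    using True by (intro measurable_component_singleton) simp
  ultimately show ?thesis by (rule measurable_compose)
next
  case False
  have "f B ms = (if B \<in> symbols L then undefined else undefined ms)" if "f \<in> space (code_space L)" for f
    using that False by (cases "B \<in> symbols L")
      (auto simp: space_code_space PiE_def extensional_def Pi_def)
  then show ?thesis
    using measurable_cong[of "code_space L" "\<lambda>f. f B ms" "\<lambda>_. if B \<in> symbols L then undefined else undefined ms" borel]
    by simp
qed

lemma measurable_finite_net [measurable]: "Measurable.pred (code_space L) (\<lambda>f. finite_net L Q f n k c)"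
  unfolding finite_net_def code_dist_def Ball_def Bex_def
  by (intro pred_intros_logic pred_intros_countable) measurable

lemma measurable_encode: "encode L Q \<in> borel_measurable (code_space L)"
proof (rule measurable_coordinatewise_then_product)
  fix i :: "nat + nat \<times> nat"
  show "(\<lambda>f. encode L Q f i) \<in> borel_measurable (code_space L)"
  proof (cases i)
    case (Inl j)
    then show ?thesis by (simp add: encode_def split_beta)
  next
    case (Inr p)
    obtain n k where p: "p = (n, k)" by fastforce
    have "(\<lambda>f. LEAST c. finite_net L Q f n k c) \<in> measurable (code_space L) (count_space UNIV)"
      by (rule measurable_Least) (rule measurable_finite_net)
    then have "(\<lambda>f. real (LEAST c. finite_net L Q f n k c)) \<in> borel_measurable (code_space L)"
      by (rule measurable_compose) simp
    then show ?thesis by (simp only: encode_def Inr p sum.case prod.case)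
  qed
qed

lemma measurable_decode: "decode L \<in> measurable borel (code_space L)"
  unfolding decode_def[abs_def] code_space_def
  by (intro measurable_restrict borel_measurable_continuous_onI continuous_on_product_coordinates)

lemma space_Mod_p_space: "space (Mod_p_space L Q) = Mod_p L Q"
  by (auto simp: Mod_p_space_def space_restrict_space Mod_p_def codes_def)

text \<open>As \<open>decode\<close> is a Borel left inverse of \<open>encode\<close>, each
  measurable set of proper codes is the \<open>encode\<close>-preimage of a Borel set.\<close>

lemma standard_borel_Mod_p:
  fixes L :: "'s language"
  assumes L: "countable_language L" and Q: "admissible_filtration Q"
  shows "standard_borel (Mod_p_space L Q)"
proof (rule standard_borelI[where h = "encode L Q"])
  have dec: "decode L (encode L Q f) = f" if "f \<in> Mod_p L Q" for f
    by (rule decode_encode[OF L]) (use that in \<open>auto simp: Mod_p_def codes_def\<close>)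
  show "encode L Q \<in> borel_measurable (Mod_p_space L Q)"
    unfolding Mod_p_space_def by (rule measurable_restrict_space1[OF measurable_encode])
  show "inj_on (encode L Q) (space (Mod_p_space L Q))"
    unfolding space_Mod_p_space by (rule inj_on_inverseI) (rule dec)
  show "gdelta_in euclidean (encode L Q ` space (Mod_p_space L Q))"
    unfolding space_Mod_p_space by (rule gdelta_encode_image[OF L Q])
  fix A assume "A \<in> sets (Mod_p_space L Q)"
  then obtain A' where A': "A' \<in> sets (code_space L)" "A = Mod_p L Q \<inter> A'"
    unfolding Mod_p_space_def sets_restrict_space by blast
  have "decode L -` A' \<in> sets borel"
    using measurable_sets[OF measurable_decode A'(1)] by simp
  moreover have "A = encode L Q -` (decode L -` A') \<inter> space (Mod_p_space L Q)"
    using dec A'(2) unfolding space_Mod_p_space by auto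
  ultimately show "\<exists>C\<in>sets borel. A = encode L Q -` C \<inter> space (Mod_p_space L Q)"
    by blast
qed

text \<open>Witnesses are lists of natural numbers, so the existential quantifier is a countable
  union; this is the gain from testing codes instead of points of the domains.\<close>

lemma measurable_realized [measurable]: "Measurable.pred (code_space L) (\<lambda>f. realized L Q f m cs)"
  unfolding realized_def split_beta Ball_def by measurable

lemma measurable_invariant: "invariant L Q \<in> borel_measurable (code_space L)"
proof (rule measurable_coordinatewise_then_product)
  fix i
  show "(\<lambda>f. invariant L Q f i) \<in> borel_measurable (code_space L)"
    unfolding invariant_def split_beta of_bool_def by measurable
qed

theorem corollary5p4:
  fixes L :: "'s language" and Q :: "nat \<Rightarrow> nat set"
  assumes "countable_language L"
    and "admissible_filtration Q"
  shows "smooth (Mod_p_space L Q) (isomorphism_relation L Q)"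
proof -
  note iff = isomorphism_relation_iff_invariant[OF assms]
  have sub: "isomorphism_relation L Q \<subseteq> Mod_p L Q \<times> Mod_p L Q"
    by (auto simp: isomorphism_relation_def)
  \<comment> \<open>As the kernel of \<open>invariant\<close> on the proper codes, the relation is
    an equivalence; transitivity needs no composition of isomorphisms.\<close>
  have "isomorphism_relation L Q =
      {(f, f'). f \<in> Mod_p L Q \<and> f' \<in> Mod_p L Q \<and> invariant L Q f = invariant L Q f'}"
    using sub iff by blast
  then have "equiv (Mod_p L Q) (isomorphism_relation L Q)"
    by (auto intro!: equivI refl_onI symI transI)
  moreover have "invariant L Q \<in> Mod_p_space L Q \<rightarrow>\<^sub>M borel_of euclidean"
    unfolding borel_of_euclidean Mod_p_space_def
    by (rule measurable_restrict_space1[OF measurable_invariant])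
  ultimately show ?thesis
    unfolding smooth_def space_Mod_p_space
    using standard_borel_Mod_p[OF assms] polish_topology_euclidean iff by blast
qed

end
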